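(* For every real number $s\in[1,4]$, $$ \frac{-2\gamma_1(1-\gamma)^2}{(1-\gamma - 2\gamma_1(s-1))^2} \leq [(s-1)\zeta(s)]'' \leq -\frac{2\gamma_1-\frac{1}{4}(1 - \gamma)(s-1) - \frac{1}{4}\gamma_1 (s-1)^2}{\left(1 + \frac{1}{8}(s-1)^2\right)^2}, $$ where the double prime denotes the second derivative with respect to $s$, and $(s-1)\zeta(s)$ is understood as the entire function obtained by removing the singularity at $s=1$.
   Context: $\zeta$ denotes the Riemann zeta function. The Stieltjes constants $\gamma_n$ ($n\geq 0$) are defined by the Laurent expansion of $\zeta$ at $s=1$: $$\zeta(s) = \frac{1}{s-1} + \sum_{n=0}^{\infty}\frac{(-1)^n}{n!}\gamma_n(s-1)^n .$$ In particular $\gamma_0=\gamma=0.57721\ldots$ is the Euler--Mascheroni constant and $\gamma_1 = -0.072815\ldots$. The function $(s-1)\zeta(s)$ has a removable singularity at $s=1$ (with value $1$ there) and extends to an entire function. *)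

theory Defs
  imports "HOL-Complex_Analysis.Complex_Analysis"
begin

definition zeta_spec :: "(complex \<Rightarrow> complex) \<Rightarrow> bool" where
  "zeta_spec f \<longleftrightarrow> f holomorphic_on - {1} \<and>
     (\<forall>s. Re s > 1 \<longrightarrow> f s = (\<Sum>n. of_nat (Suc n) powr - s)) \<and> f 1 = 0"

lemma holomorphic_on_suminf_halfplane:
  fixes f :: "nat \<Rightarrow> complex \<Rightarrow> complex" and C :: "complex \<Rightarrow> real"
  assumes hol: "\<And>n. f n holomorphic_on {s. Re s > c}"
    and C: "continuous_on UNIV C"
    and le: "\<And>n s. Re s > c \<Longrightarrow> norm (f n s) \<le> C s * real (Suc n) powr (- (Re s - c) - 1)"
  shows "(\<lambda>s. \<Sum>n. f n s) holomorphic_on {s. Re s > c}"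
    and "\<And>s. Re s > c \<Longrightarrow> summable (\<lambda>n. f n s)"
proof -
  have summ: "summable (\<lambda>n. real (Suc n) powr (- d - 1))" if "d > 0" for d :: real
    using that by (subst summable_Suc_iff) (simp add: summable_real_powr_iff)
  show "summable (\<lambda>n. f n s)" if "Re s > c" for s
  proof (rule summable_comparison_test')
    show "summable (\<lambda>n. C s * real (Suc n) powr (- (Re s - c) - 1))"
      using summ[of "Re s - c"] that by (intro summable_mult) auto
  qed (use le[OF that] in auto)
  show "(\<lambda>s. \<Sum>n. f n s) holomorphic_on {s. Re s > c}"
  proof (rule holomorphic_uniform_sequence)
    show "open {s. Re s > c}" by (rule open_halfspace_Re_gt)
    show "(\<lambda>s. \<Sum>i<n. f i s) holomorphic_on {s. Re s > c}" for n
      by (intro holomorphic_intros hol)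
    fix x assume x: "x \<in> {s. Re s > c}"
    define d where "d = (Re x - c) / 2"
    have d: "d > 0" using x by (simp add: d_def)
    have Re_ge: "Re s - c \<ge> d" if "s \<in> cball x d" for s
    proof -
      have "\<bar>Re (x - s)\<bar> \<le> norm (x - s)" by (rule abs_Re_le_cmod)
      also have "\<dots> \<le> d" using that by (simp add: dist_norm)
      finally have "Re x - Re s \<le> d" by simp
      thus ?thesis unfolding d_def by (simp add: field_simps)
    qed
    have sub: "cball x d \<subseteq> {s. Re s > c}"
    proof
      fix s assume "s \<in> cball x d"
      from Re_ge[OF this] d show "s \<in> {s. Re s > c}" by simp
    qed
    have "compact (C ` cball x d)"
      by (intro compact_continuous_image continuous_on_subset[OF C]) auto
    then obtain B where B: "\<And>s. s \<in> cball x d \<Longrightarrow> \<bar>C s\<bar> \<le> B"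
      using compact_imp_bounded[of "C ` cball x d"] unfolding bounded_real by blast
    have "uniform_limit (cball x d) (\<lambda>n s. \<Sum>i<n. f i s) (\<lambda>s. \<Sum>i. f i s) sequentially"
    proof (rule Weierstrass_m_test)
      show "summable (\<lambda>n. B * real (Suc n) powr (- d - 1))"
        using summ[OF d] by (intro summable_mult) auto
      fix n s assume s: "s \<in> cball x d"
      have "norm (f n s) \<le> C s * real (Suc n) powr (- (Re s - c) - 1)"
        using s sub by (intro le) auto
      also have "\<dots> \<le> B * real (Suc n) powr (- d - 1)"
        using B[OF s] Re_ge[OF s] by (intro mult_mono powr_mono) auto
      finally show "norm (f n s) \<le> B * real (Suc n) powr (- d - 1)" .
    qed
    with d sub show "\<exists>d>0. cball x d \<subseteq> {s. Re s > c} \<and>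
        uniform_limit (cball x d) (\<lambda>n s. \<Sum>i<n. f i s) (\<lambda>s. \<Sum>i. f i s) sequentially"
      by blast
  qed
qed

lemma powr_Suc_Taylor_bound:
  fixes a :: complex
  assumes "Re a \<le> of_nat (Suc K)"
  shows "norm (of_nat (Suc (Suc n)) powr a - (\<Sum>k\<le>K. (a gchoose k) * of_nat (Suc n) powr (a - of_nat k)))
           \<le> norm (\<Prod>j<Suc K. a - of_nat j) / fact K * real (Suc n) powr (Re a - of_nat (Suc K))"
proof -
  define F where "F = (\<lambda>i (x::complex). (\<Prod>j<i. a - of_nat j) * x powr (a - of_nat i))"
  define S where "S = closed_segment (of_nat (Suc n) :: complex) (of_nat (Suc (Suc n)))"
  have S: "\<exists>y\<ge>real (Suc n). x = of_real y" if "x \<in> S" for x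
  proof -
    have "x \<in> closed_segment (of_real (real (Suc n))) (of_real (real (Suc (Suc n))))"
      using that by (simp add: S_def)
    hence "x \<in> of_real ` closed_segment (real (Suc n)) (real (Suc (Suc n)))"
      by (simp only: closed_segment_of_real)
    thus ?thesis by (auto simp: closed_segment_eq_real_ivl)
  qed
  have "norm (F 0 (of_nat (Suc (Suc n))) - (\<Sum>i\<le>K. F i (of_nat (Suc n)) *
          (of_nat (Suc (Suc n)) - of_nat (Suc n)) ^ i / (fact i)))
        \<le> (norm (\<Prod>j<Suc K. a - of_nat j) * real (Suc n) powr (Re a - of_nat (Suc K))) *
           norm (of_nat (Suc (Suc n)) - of_nat (Suc n) :: complex) ^ Suc K / fact K"
  proof (rule complex_Taylor[where S = S])
    show "convex S" by (simp add: S_def)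
    show "(F i has_field_derivative F (Suc i) x) (at x within S)" if "x \<in> S" for i x
    proof -
      from S[OF that] have "x \<notin> \<real>\<^sub>\<le>\<^sub>0" by (auto simp: complex_nonpos_Reals_iff)
      hence "(F i has_field_derivative (\<Prod>j<i. a - of_nat j) *
                ((a - of_nat i) * x powr (a - of_nat i - 1))) (at x within S)"
        unfolding F_def by (intro DERIV_cmult has_field_derivative_at_within[OF has_field_derivative_powr])
      also have "(\<Prod>j<i. a - of_nat j) * ((a - of_nat i) * x powr (a - of_nat i - 1)) = F (Suc i) x"
        by (simp add: F_def algebra_simps)
      finally show ?thesis .
    qed
    show "norm (F (Suc K) x) \<le> norm (\<Prod>j<Suc K. a - of_nat j) * real (Suc n) powr (Re a - of_nat (Suc K))"
      if "x \<in> S" for x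
    proof -
      from S[OF that] obtain y where y: "y \<ge> real (Suc n)" "x = of_real y" by blast
      have "norm (x powr (a - of_nat (Suc K))) = y powr (Re a - real (Suc K))"
        using y by (subst norm_powr_real_powr) auto
      also have "\<dots> \<le> real (Suc n) powr (Re a - real (Suc K))"
        using y assms by (intro powr_mono2') auto
      finally show ?thesis unfolding F_def norm_mult
        by (intro mult_left_mono) auto
    qed
  qed (auto simp: S_def)
  also have "norm (of_nat (Suc (Suc n)) - of_nat (Suc n) :: complex) = 1" by simp
  also have "F 0 (of_nat (Suc (Suc n))) = of_nat (Suc (Suc n)) powr a" by (simp add: F_def)
  also have "(\<Sum>i\<le>K. F i (of_nat (Suc n)) * (of_nat (Suc (Suc n)) - of_nat (Suc n)) ^ i / (fact i))
     = (\<Sum>k\<le>K. (a gchoose k) * of_nat (Suc n) powr (a - of_nat k))"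
    by (intro sum.cong) (auto simp: F_def gbinomial_prod_rev atLeast0LessThan)
  finally show ?thesis by (simp add: field_simps)
qed

lemma zeta_continuation_step:
  "\<exists>g. g holomorphic_on {s. Re s > 1 - real N} \<and>
       (\<forall>s. Re s > 1 \<longrightarrow> g s = (s - 1) * (\<Sum>n. of_nat (Suc n) powr - s))"
proof (induction N)
  define Z where "Z = (\<lambda>s::complex. \<Sum>n. of_nat (Suc n) powr - s)"
  have Z_hol: "Z holomorphic_on {s. Re s > 1}"
    and Z_summ: "\<And>s::complex. Re s > 1 \<Longrightarrow> summable (\<lambda>n. of_nat (Suc n) powr - s)"
  proof -
    have le: "norm (of_nat (Suc n) powr - s :: complex) \<le> 1 * real (Suc n) powr (- (Re s - 1) - 1)"
      for n and s :: complex
      using norm_powr_real_powr[of "of_nat (Suc n)" "- s"] by simp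
    have hol: "(\<lambda>s. of_nat (Suc n) powr - s :: complex) holomorphic_on {s. Re s > 1}" for n
      by (intro holomorphic_intros) (auto simp: complex_nonpos_Reals_iff)
    show "Z holomorphic_on {s. Re s > 1}"
      unfolding Z_def
      by (rule holomorphic_on_suminf_halfplane(1)[where C = "\<lambda>_. 1", OF hol _ le]) auto
    show "summable (\<lambda>n. of_nat (Suc n) powr - s)" if "Re s > 1" for s :: complex
      by (rule holomorphic_on_suminf_halfplane(2)[where C = "\<lambda>_. 1", OF hol _ le that]) auto
  qed
  {
    case 0
    have "(\<lambda>s. (s - 1) * Z s) holomorphic_on {s. Re s > 1}"
      by (intro holomorphic_intros Z_hol)
    thus ?case by (auto simp: Z_def)
  next
    case (Suc N)
    then obtain g where g: "g holomorphic_on {s. Re s > 1 - real N}"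
      and g_eq: "\<And>s. Re s > 1 \<Longrightarrow> g s = (s - 1) * Z s"
      unfolding Z_def by blast
    define K where "K = Suc N"
    define h where "h = (\<lambda>n (s::complex). of_nat (Suc (Suc n)) powr (1 - s)
        - (\<Sum>k\<le>K. ((1 - s) gchoose k) * of_nat (Suc n) powr (1 - s - of_nat k)))"
    define C where "C = (\<lambda>s::complex. norm (\<Prod>j<Suc K. 1 - s - of_nat j) / fact K)"
    have h_hol: "h n holomorphic_on {s. Re s > 1 - real K}" for n
      unfolding h_def gbinomial_prod_rev
      by (intro holomorphic_intros) (auto simp: complex_nonpos_Reals_iff)
    have C: "continuous_on UNIV C"
      unfolding C_def by (intro continuous_intros) auto
    have h_le: "norm (h n s) \<le> C s * real (Suc n) powr (- (Re s - (1 - real K)) - 1)"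
      if "Re s > 1 - real K" for n s
      using powr_Suc_Taylor_bound[of "1 - s" K n] that by (simp add: h_def C_def algebra_simps)
    define H where "H = (\<lambda>s. \<Sum>n. h n s)"
    have H_hol: "H holomorphic_on {s. Re s > 1 - real K}"
      unfolding H_def by (rule holomorphic_on_suminf_halfplane(1)[OF h_hol C h_le])
    define g' where "g' = (\<lambda>s. 1 + H s - (\<Sum>j=1..N. ((1 - s) gchoose j) / of_nat (Suc j) * g (s + of_nat j)))"
    have "g' holomorphic_on {s. Re s > 1 - real K}"
    proof -
      have "(\<lambda>s. g (s + of_nat j)) holomorphic_on {s. Re s > 1 - real K}" if "j \<in> {1..N}" for j
      proof -
        have "(g \<circ> (\<lambda>s. s + of_nat j)) holomorphic_on {s. Re s > 1 - real K}"
          by (rule holomorphic_on_compose_gen[OF _ g])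
             (use that in \<open>auto intro!: holomorphic_intros simp: K_def\<close>)
        thus ?thesis by (simp add: o_def)
      qed
      thus ?thesis unfolding g'_def gbinomial_prod_rev
        by (intro holomorphic_intros H_hol) auto
    qed
    moreover have "g' s = (s - 1) * Z s" if s: "Re s > 1" for s
    proof -
      have Z_sums: "(\<lambda>n. of_nat (Suc n) powr - w) sums Z w" if "Re w > 1" for w
        using Z_summ[OF that] unfolding Z_def by (rule summable_sums)
      have lim: "(\<lambda>n. of_nat (Suc n) powr (1 - s) :: complex) \<longlonglongrightarrow> 0"
      proof (rule Lim_null_comparison)
        show "eventually (\<lambda>n. norm (of_nat (Suc n) powr (1 - s) :: complex)
                \<le> real (Suc n) powr (1 - Re s)) sequentially"
          using norm_powr_real_powr[of "of_nat (Suc _)" "1 - s"] by simp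
        have "((\<lambda>x. x powr (1 - Re s)) \<longlongrightarrow> 0) at_top"
          using s by (intro tendsto_neg_powr filterlim_ident) auto
        moreover have "filterlim (\<lambda>n. real (Suc n)) at_top sequentially"
          by (rule filterlim_compose[OF filterlim_real_sequentially filterlim_Suc])
        ultimately show "(\<lambda>n. real (Suc n) powr (1 - Re s)) \<longlonglongrightarrow> 0"
          by (rule filterlim_compose)
      qed
      have "(\<lambda>n. of_nat (Suc (Suc n)) powr (1 - s) - of_nat (Suc n) powr (1 - s) :: complex)
              sums (0 - of_nat (Suc 0) powr (1 - s))"
        by (rule telescope_sums[OF lim])
      hence tele: "(\<lambda>n. of_nat (Suc (Suc n)) powr (1 - s) - of_nat (Suc n) powr (1 - s) :: complex) sums (-1)"
        by simp
      have "(\<lambda>n. \<Sum>j\<le>N. ((1 - s) gchoose Suc j) * of_nat (Suc n) powr - (s + of_nat j))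
              sums (\<Sum>j\<le>N. ((1 - s) gchoose Suc j) * Z (s + of_nat j))"
        by (intro sums_sum sums_mult Z_sums) (use s in auto)
      from sums_diff[OF tele this]
      have "(\<lambda>n. h n s) sums (-1 - (\<Sum>j\<le>N. ((1 - s) gchoose Suc j) * Z (s + of_nat j)))"
      proof (rule sums_cong[THEN iffD1, rotated])
        fix n
        show "of_nat (Suc (Suc n)) powr (1 - s) - of_nat (Suc n) powr (1 - s) -
              (\<Sum>j\<le>N. ((1 - s) gchoose Suc j) * of_nat (Suc n) powr - (s + of_nat j)) = h n s"
          unfolding h_def K_def sum.atMost_Suc_shift by (simp add: algebra_simps)
      qed
      hence H: "H s = -1 - (\<Sum>j\<le>N. ((1 - s) gchoose Suc j) * Z (s + of_nat j))"
        unfolding H_def by (rule sums_unique[symmetric])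
      have "(\<Sum>j\<le>N. ((1 - s) gchoose Suc j) * Z (s + of_nat j)) =
            (1 - s) * Z s + (\<Sum>j=1..N. ((1 - s) gchoose Suc j) * Z (s + of_nat j))"
        by (simp add: atMost_atLeast0 sum.atLeast_Suc_atMost)
      also have "(\<Sum>j=1..N. ((1 - s) gchoose Suc j) * Z (s + of_nat j)) =
                 -(\<Sum>j=1..N. ((1 - s) gchoose j) / of_nat (Suc j) * g (s + of_nat j))"
        unfolding sum_negf[symmetric]
      proof (rule sum.cong)
        fix j assume "j \<in> {1..N}"
        have gc: "((1 - s) gchoose Suc j) = ((1 - s) gchoose j) * (1 - s - of_nat j) / of_nat (Suc j)"
          by (simp add: gbinomial_prod_rev)
        have gj: "g (s + of_nat j) = (s + of_nat j - 1) * Z (s + of_nat j)"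
          using s by (intro g_eq) auto
        have "((1 - s) gchoose j) * (1 - s - of_nat j) * Z (s + of_nat j) =
              - (((1 - s) gchoose j) * ((s + of_nat j - 1) * Z (s + of_nat j)))"
          by (simp add: algebra_simps)
        thus "((1 - s) gchoose Suc j) * Z (s + of_nat j) =
              - (((1 - s) gchoose j) / of_nat (Suc j) * g (s + of_nat j))"
          unfolding gc gj by (simp only: times_divide_eq_left minus_divide_left)
      qed simp
      finally show ?thesis unfolding g'_def H by (simp add: algebra_simps)
    qed
    ultimately show ?case unfolding Z_def K_def by blast
  }
qed

lemma zeta_spec_unique_existence: "\<exists>!f. zeta_spec f"
proof (rule ex_ex1I)
  define Z where "Z = (\<lambda>s::complex. \<Sum>n. of_nat (Suc n) powr - s)"
  define D where "D = (\<lambda>N. {s::complex. Re s > 1 - real N})"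
  obtain G where G: "\<And>N. G N holomorphic_on D N"
    and G_eq: "\<And>N s. Re s > 1 \<Longrightarrow> G N s = (s - 1) * Z s"
    using zeta_continuation_step unfolding D_def Z_def by metis
  have op: "open (D N)" for N unfolding D_def by (rule open_halfspace_Re_gt)
  have mono: "D M \<subseteq> D N" if "M \<le> N" for M N using that by (auto simp: D_def)
  have eq: "G N s = G M s" if "s \<in> D M" "M \<le> N" for M N s
  proof (rule analytic_continuation_open[of "D 0" "D M" "G N" "G M"])
    show "connected (D M)" unfolding D_def
      by (intro convex_connected convex_halfspace_Re_gt)
    have "2 \<in> D 0" by (simp add: D_def)
    thus "D 0 \<noteq> {}" by blast
    show "G N holomorphic_on D M"
      by (rule holomorphic_on_subset[OF G mono]) fact
    show "G N z = G M z" if "z \<in> D 0" for z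
      using that by (simp add: D_def G_eq)
  qed (use that op mono G in auto)
  define N where "N = (\<lambda>s. LEAST N. s \<in> D N)"
  define g where "g = (\<lambda>s. G (N s) s)"
  have ex: "\<exists>N. s \<in> D N" for s
  proof -
    obtain N where "real N > 1 - Re s" using reals_Archimedean2 by blast
    thus ?thesis by (intro exI[of _ N]) (auto simp: D_def)
  qed
  have g_eq: "g s = G M s" if "s \<in> D M" for M s
  proof -
    have "s \<in> D (N s)" unfolding N_def by (rule LeastI_ex[OF ex])
    moreover have "N s \<le> M" unfolding N_def by (rule Least_le[of "\<lambda>N. s \<in> D N", OF that])
    ultimately show ?thesis unfolding g_def using eq[of s "N s" M] by simp
  qed
  have "g holomorphic_on (\<Union>M\<in>UNIV. D M)"
  proof (rule holomorphic_on_UN_open)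
    show "g holomorphic_on D M" for M
      using G[of M] by (rule holomorphic_transform) (simp add: g_eq)
  qed (rule op)
  also have "(\<Union>M\<in>UNIV. D M) = UNIV" using ex by blast
  finally have g: "g holomorphic_on UNIV" .
  define f where "f = (\<lambda>s. if s = 1 then 0 else g s / (s - 1))"
  have "f holomorphic_on - {1}"
  proof (rule holomorphic_transform)
    show "(\<lambda>s. g s / (s - 1)) holomorphic_on - {1}"
      by (intro holomorphic_intros holomorphic_on_subset[OF g]) auto
  qed (auto simp: f_def)
  moreover have "f s = Z s" if "Re s > 1" for s
  proof -
    have "s \<noteq> 1" using that by auto
    thus ?thesis using g_eq[of s 0] G_eq[of s 0] that by (simp add: f_def D_def)
  qed
  ultimately show "\<exists>f. zeta_spec f"
    unfolding zeta_spec_def Z_def by (intro exI[of _ f]) (auto simp: f_def)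
next
  fix f1 f2 assume "zeta_spec f1" "zeta_spec f2"
  note f = this[unfolded zeta_spec_def]
  have "f1 s = f2 s" if "s \<noteq> 1" for s
  proof (rule analytic_continuation_open[of "{s. Re s > 1}" "- {1}" f1 f2])
    show "connected (- {1::complex})"
      by (rule connected_punctured_universe) simp
    have "2 \<in> {s. Re s > 1}" by simp
    thus "{s. Re s > 1} \<noteq> {}" by blast
  qed (use f that in \<open>auto simp: open_halfspace_Re_gt\<close>)
  thus "f1 = f2" using f by (intro ext) metis
qed

text \<open>
  The Riemann zeta function is the analytic continuation of its Dirichlet series to the complex
  plane without 1.  Its value at the pole is fixed to 0, by convention.
\<close>
definition zeta :: "complex \<Rightarrow> complex" where
  "zeta = (THE f. zeta_spec f)"

lemma zeta_spec_zeta: "zeta_spec zeta"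
  unfolding zeta_def using zeta_spec_unique_existence by (rule theI')

text \<open>
  The coefficient of \<open>(s - 1) ^ n\<close> in the Laurent expansion of \<open>zeta\<close> at 1 is
  \<open>(-1) ^ n / n! * stieltjes n\<close>.
\<close>
definition stieltjes :: "nat \<Rightarrow> real" where
  "stieltjes n = Re ((-1) ^ n * fact n * fls_nth (laurent_expansion zeta 1) (int n))"

end

theory Submission
  imports Defs
begin

text \<open>
  Let \<open>f s = (s - 1) * zeta s\<close> be the entire function of the theorem, \<open>u = s - 1\<close>, \<open>c = 1 - euler_mascheroni\<close> and
  \<open>g = f''(1)\<close>.  Dividing the Taylor series of \<open>f\<close> by \<open>s - 1\<close> shows \<open>g = - 2 * stieltjes 1\<close>, so the claim is

    \<open>g * c\<^sup>2 / (c + g * u)\<^sup>2 \<le> f''(1 + u) \<le> (g + c * u / 4 - g * u\<^sup>2 / 8) / (1 + u\<^sup>2 / 8)\<^sup>2\<close>  for \<open>u \<in> {0..3}\<close>.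

  At \<open>u = 0\<close> all three expressions are equal to \<open>g\<close>.  The inequalities hold because \<open>f''\<close> is almost linear on this
  interval: it falls from about 0.146 to about 0.057, and its slope stays between -0.033 and -0.022.  The
  lower bound starts with the much steeper slope \<open>- 2 * g\<^sup>2 / c\<close>, about -0.100, and the upper bound
  with the positive slope \<open>c / 4\<close>, about 0.106.  So for small \<open>u\<close> it is enough to compare slopes, for which
  rough bounds for \<open>g\<close> suffice; for larger \<open>u\<close> the bounds have moved away from \<open>f''\<close>, and it is
  enough to know \<open>f''\<close> up to an error of about 0.005.

  Both pieces of information come from the Euler--Maclaurin formula.  Summing \<open>(s - 1) * n powr - s\<close> over
  \<open>n < 4\<close> and adding the boundary terms at \<open>n = 4\<close> gives \<open>f = E + R\<close> for \<open>Re s > -3\<close>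
  (lemma \<open>zeta_euler_maclaurin\<close>), where \<open>E\<close> is an explicit combination of 1, \<open>2 powr - s\<close>, \<open>3 powr - s\<close> and
  \<open>4 powr - s\<close> with polynomial coefficients.  As the formula is valid for complex \<open>s\<close>, no derivative of the remainder
  has to be computed: \<open>R\<close> is bounded by 8/3087 on all unit discs around real points \<open>s \<ge> 1\<close>, and Cauchy's
  inequality bounds \<open>R''\<close> by 16/3087 and \<open>R'''\<close> by 48/3087 (lemma \<open>norm_higher_deriv_zeta_remainder_le\<close>).
  Replacing the exponentials by polynomials shows that the third
  derivative of the main part lies between -0.039 and -0.015 (lemma \<open>zeta_main_D3_bounds\<close>); its second
  derivative at \<open>s = 1\<close> and at \<open>s = 4\<close> is a polynomial in \<open>ln 2\<close> and \<open>ln 3\<close>.  Together with the bounds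
  19/33 and 13/22 for the Euler--Mascheroni constant, this reduces the theorem to four elementary polynomial
  inequalities: the lower and the upper bound for \<open>u \<le> 5/4\<close> and for \<open>u \<ge> 5/4\<close>.
\<close>

section \<open>The trapezoidal rule with end correction\<close>

lemma norm_le_if_deriv_le_power:
  fixes f f' :: "real \<Rightarrow> 'a::real_normed_vector"
  assumes "\<And>x. x \<in> {a..b} \<Longrightarrow> (f has_vector_derivative f' x) (at x)"
    and "\<And>x. x \<in> {a..b} \<Longrightarrow> norm (f' x) \<le> C * (x - a) ^ k"
    and "f a = 0" "x \<in> {a..b}"
  shows "norm (f x) \<le> C / real (Suc k) * (x - a) ^ Suc k"
proof (cases "x = a")
  case False
  hence "a < x" using assms(4) by auto
  let ?\<phi> = "\<lambda>x. C / real (Suc k) * (x - a) ^ Suc k"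
  have "norm (f x - f a) \<le> ?\<phi> x - ?\<phi> a"
  proof (rule differentiable_bound_general[OF \<open>a < x\<close>])
    show "continuous_on {a..x} f"
      using assms(4) by (intro continuous_at_imp_continuous_on ballI has_vector_derivative_continuous[OF assms(1)]) auto
    show "continuous_on {a..x} ?\<phi>" by (intro continuous_intros)
    show "(f has_vector_derivative f' y) (at y)" if "a < y" "y < x" for y
      using that assms(1,4) by auto
    show "(?\<phi> has_vector_derivative C * (y - a) ^ k) (at y)" if "a < y" "y < x" for y
      unfolding has_real_derivative_iff_has_vector_derivative[symmetric]
      by (rule derivative_eq_intros refl | simp)+
    show "norm (f' y) \<le> C * (y - a) ^ k" if "a < y" "y < x" for y
      using that assms(2,4) by auto
  qed
  thus ?thesis using assms(3) by simp
qed (use assms(3) in simp)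

text \<open>
  The error, as a function \<open>\<Phi>\<close> of the right end point of the interval, vanishes at the left end point
  together with its first two derivatives, and three differentiations cancel everything except the single term
  \<open>(x - a)\<^sup>2 / 12 * h4 x\<close>.  Integrating the bound for \<open>h4\<close> back three times gives the sharp constant
  \<open>1 / (12 * 3 * 4 * 5) = 1 / 720\<close>.
\<close>
lemma corrected_trapezoid_error_le:
  fixes H h h1 h2 h3 h4 :: "real \<Rightarrow> 'a::real_normed_field"
  assumes H: "\<And>x. x \<in> {a..a+1} \<Longrightarrow> (H has_vector_derivative h x) (at x)"
    and h: "\<And>x. x \<in> {a..a+1} \<Longrightarrow> (h has_vector_derivative h1 x) (at x)"
    and h1: "\<And>x. x \<in> {a..a+1} \<Longrightarrow> (h1 has_vector_derivative h2 x) (at x)"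
    and h2: "\<And>x. x \<in> {a..a+1} \<Longrightarrow> (h2 has_vector_derivative h3 x) (at x)"
    and h3: "\<And>x. x \<in> {a..a+1} \<Longrightarrow> (h3 has_vector_derivative h4 x) (at x)"
    and le: "\<And>x. x \<in> {a..a+1} \<Longrightarrow> norm (h4 x) \<le> M"
  shows "norm ((1/2) *\<^sub>R (h a + h (a+1)) - (H (a+1) - H a) - (1/12) *\<^sub>R (h1 (a+1) - h1 a)) \<le> M / 720"
proof -
  define \<Phi> where "\<Phi> x = H x - H a - ((x - a) / 2) *\<^sub>R (h a + h x) + ((x - a)\<^sup>2 / 12) *\<^sub>R (h1 x - h1 a)" for x
  define \<Phi>1 where "\<Phi>1 x = (1/2) *\<^sub>R (h x - h a) - ((x - a) / 3) *\<^sub>R h1 x - ((x - a) / 6) *\<^sub>R h1 a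
      + ((x - a)\<^sup>2 / 12) *\<^sub>R h2 x" for x
  define \<Phi>2 where "\<Phi>2 x = (1/6) *\<^sub>R (h1 x - h1 a) - ((x - a) / 6) *\<^sub>R h2 x + ((x - a)\<^sup>2 / 12) *\<^sub>R h3 x" for x
  define \<Phi>3 where "\<Phi>3 x = ((x - a)\<^sup>2 / 12) *\<^sub>R h4 x" for x
  have d1: "(\<Phi> has_vector_derivative \<Phi>1 x) (at x)" if "x \<in> {a..a+1}" for x
    unfolding \<Phi>_def[abs_def] \<Phi>1_def
    by (auto intro!: derivative_eq_intros H h h1 that simp: scaleR_conv_of_real field_simps power2_eq_square)
  have d2: "(\<Phi>1 has_vector_derivative \<Phi>2 x) (at x)" if "x \<in> {a..a+1}" for x
    unfolding \<Phi>1_def[abs_def] \<Phi>2_def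
    by (auto intro!: derivative_eq_intros h h1 h2 that simp: scaleR_conv_of_real field_simps power2_eq_square)
  have d3: "(\<Phi>2 has_vector_derivative \<Phi>3 x) (at x)" if "x \<in> {a..a+1}" for x
    unfolding \<Phi>2_def[abs_def] \<Phi>3_def
    by (auto intro!: derivative_eq_intros h1 h2 h3 that simp: scaleR_conv_of_real field_simps power2_eq_square)
  have "norm (\<Phi>3 x) \<le> M / 12 * (x - a)\<^sup>2" if "x \<in> {a..a+1}" for x
    using mult_left_mono[OF le[OF that], of "(x - a)\<^sup>2 / 12"] by (simp add: \<Phi>3_def field_simps)
  from norm_le_if_deriv_le_power[where a = a and b = "a + 1", OF d3 this]
  have "norm (\<Phi>2 x) \<le> M / 12 / 3 * (x - a) ^ 3" if "x \<in> {a..a+1}" for x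
    using that by (simp add: \<Phi>2_def eval_nat_numeral)
  from norm_le_if_deriv_le_power[where a = a and b = "a + 1", OF d2 this]
  have "norm (\<Phi>1 x) \<le> M / 144 * (x - a) ^ 4" if "x \<in> {a..a+1}" for x
    using that by (simp add: \<Phi>1_def eval_nat_numeral)
  from norm_le_if_deriv_le_power[where a = a and b = "a + 1", OF d1 this, of "a + 1"]
  have "norm (\<Phi> (a+1)) \<le> M / 720" by (simp add: \<Phi>_def)
  thus ?thesis by (subst norm_minus_cancel[symmetric]) (simp add: \<Phi>_def algebra_simps)
qed

lemma has_vector_derivative_of_real_powr:
  fixes c w :: complex
  assumes "x > 0"
  shows "((\<lambda>x. c * of_real x powr w) has_vector_derivative (c * w) * of_real x powr (w - 1)) (at x)"
proof (rule has_vector_derivative_real_field)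
  show "((\<lambda>z. c * z powr w) has_field_derivative (c * w) * of_real x powr (w - 1)) (at (of_real x))"
    using assms by (auto intro!: derivative_eq_intros)
qed

text \<open>
  The Euler--Maclaurin boundary terms of \<open>x \<mapsto> (w - 1) * x powr - w\<close> at \<open>x = n\<close>: the integral from \<open>n\<close>
  to infinity (if \<open>Re w > 1\<close>), half of the value, and minus one twelfth of the derivative.
\<close>
definition em_boundary :: "nat \<Rightarrow> complex \<Rightarrow> complex" where
  "em_boundary n w = of_nat n powr (1 - w) + (w - 1) / 2 * of_nat n powr - w
     + (w - 1) * w / 12 * of_nat n powr (- w - 1)"

text \<open>
  What the boundary terms miss on the interval from \<open>n\<close> to \<open>n + 1\<close>; summed over \<open>n\<close>, the differences of
  boundary terms telescope.
\<close>
definition em_error :: "nat \<Rightarrow> complex \<Rightarrow> complex" where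
  "em_error n w = (w - 1) * of_nat n powr - w + em_boundary (Suc n) w - em_boundary n w"

text \<open>
  The fourth derivative of \<open>x \<mapsto> (w - 1) * x powr - w\<close> decays like \<open>x powr (- w - 4)\<close>, so the errors are
  summable in the half plane \<open>Re w > -3\<close>, far beyond the half plane of convergence of the Dirichlet series.
\<close>
lemma norm_em_error_le:
  assumes "n > 0" "Re w \<ge> -4"
  shows "norm (em_error n w) \<le>
           norm ((w - 1) * w * (w + 1) * (w + 2) * (w + 3)) / 720 * real n powr (- Re w - 4)"
proof -
  let ?p = "\<lambda>c e x. c * complex_of_real x powr e"
  let ?h4 = "?p ((w - 1) * (-w) * (-w - 1) * (-w - 2) * (-w - 3)) (-w - 4)"
  let ?M = "norm ((w - 1) * w * (w + 1) * (w + 2) * (w + 3)) * real n powr (- Re w - 4)"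
  have D: "(?p c e has_vector_derivative ?p (c * e) e' x) (at x)"
    if "x \<in> {real n..real n + 1}" "e' = e - 1" for c e e' x
    using that has_vector_derivative_of_real_powr[of x c e] assms(1) by simp
  let ?e = "(1/2) *\<^sub>R (?p (w - 1) (-w) (real n) + ?p (w - 1) (-w) (real n + 1))
           - (?p (-1) (1 - w) (real n + 1) - ?p (-1) (1 - w) (real n))
           - (1/12) *\<^sub>R (?p ((w - 1) * (-w)) (-w - 1) (real n + 1) - ?p ((w - 1) * (-w)) (-w - 1) (real n))"
  have "norm ?e \<le> ?M / 720"
  proof (rule corrected_trapezoid_error_le)
    fix x assume x: "x \<in> {real n..real n + 1}"
    show "(?p (-1) (1 - w) has_vector_derivative ?p (w - 1) (-w) x) (at x)"
      using D[OF x, of "-w" "1 - w" "-1"] by simp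
    show "(?p (w - 1) (-w) has_vector_derivative ?p ((w - 1) * (-w)) (-w - 1) x) (at x)"
      by (rule D[OF x]) simp
    show "(?p ((w - 1) * (-w)) (-w - 1) has_vector_derivative ?p ((w - 1) * (-w) * (-w - 1)) (-w - 2) x) (at x)"
      by (rule D[OF x]) simp
    show "(?p ((w - 1) * (-w) * (-w - 1)) (-w - 2) has_vector_derivative
        ?p ((w - 1) * (-w) * (-w - 1) * (-w - 2)) (-w - 3) x) (at x)"
      by (rule D[OF x]) simp
    show "(?p ((w - 1) * (-w) * (-w - 1) * (-w - 2)) (-w - 3) has_vector_derivative ?h4 x) (at x)"
      by (rule D[OF x]) simp
    have "norm (complex_of_real x powr (-w - 4)) = x powr (- Re w - 4)"
      using x assms by (subst norm_powr_real_powr) auto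
    also have "\<dots> \<le> real n powr (- Re w - 4)"
      using x assms by (intro powr_mono2') auto
    finally have "norm (?h4 x) \<le> norm ((w - 1) * (-w) * (-w - 1) * (-w - 2) * (-w - 3)) * real n powr (- Re w - 4)"
      unfolding norm_mult by (intro mult_left_mono) auto
    moreover have "(w - 1) * (-w) * (-w - 1) * (-w - 2) * (-w - 3) = (w - 1) * w * (w + 1) * (w + 2) * (w + 3)"
      by (simp add: algebra_simps)
    ultimately show "norm (?h4 x) \<le> ?M" by metis
  qed
  moreover have "?e = em_error n w"
    by (simp add: em_error_def em_boundary_def scaleR_conv_of_real field_simps)
  ultimately show ?thesis by simp
qed

section \<open>The Euler--Maclaurin formula for the zeta function\<close>

definition zeta_remainder :: "complex \<Rightarrow> complex" where
  "zeta_remainder w = (\<Sum>n. em_error (n + 4) w)"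

text \<open>
  The cut at 4 is a compromise: it leaves three exponential terms in the main part, and a remainder
  whose second derivative is well below 0.009, the narrow gap at \<open>s = 4\<close> between the second derivative in question and
  its upper bound.
\<close>
definition zeta_main :: "complex \<Rightarrow> complex" where
  "zeta_main w = (w - 1) * (1 + 2 powr - w + 3 powr - w) + em_boundary 4 w"

lemma
  shows holomorphic_zeta_remainder: "zeta_remainder holomorphic_on {w. Re w > -3}"
    and summable_em_error: "Re w > -3 \<Longrightarrow> summable (\<lambda>n. em_error (n + 4) w)"
proof -
  define C where "C = (\<lambda>w::complex. norm ((w - 1) * w * (w + 1) * (w + 2) * (w + 3)) / 720)"
  have hol: "em_error (n + 4) holomorphic_on {w. Re w > -3}" for n
    unfolding em_error_def[abs_def] em_boundary_def[abs_def]
    by (intro holomorphic_intros) (auto simp: complex_nonpos_Reals_iff)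
  have C: "continuous_on UNIV C"
    unfolding C_def by (intro continuous_intros) auto
  have le: "norm (em_error (n + 4) w) \<le> C w * real (Suc n) powr (- (Re w - (-3)) - 1)"
    if "Re w > -3" for n w
  proof -
    have "norm (em_error (n + 4) w) \<le> C w * real (n + 4) powr (- Re w - 4)"
      unfolding C_def using that by (intro norm_em_error_le) auto
    also have "\<dots> \<le> C w * real (Suc n) powr (- Re w - 4)"
      using that by (intro mult_left_mono powr_mono2') (auto simp: C_def)
    finally show ?thesis by (simp add: algebra_simps)
  qed
  show "zeta_remainder holomorphic_on {w. Re w > -3}"
    unfolding zeta_remainder_def[abs_def] by (rule holomorphic_on_suminf_halfplane(1)[OF hol C le])
  show "Re w > -3 \<Longrightarrow> summable (\<lambda>n. em_error (n + 4) w)"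
    by (rule holomorphic_on_suminf_halfplane(2)[OF hol C le])
qed

lemma holomorphic_zeta_main: "zeta_main holomorphic_on A"
  unfolding zeta_main_def[abs_def] em_boundary_def[abs_def]
  by (intro holomorphic_intros) (auto simp: complex_nonpos_Reals_iff)

lemma zeta_sums: "Re w > 1 \<Longrightarrow> (\<lambda>n. of_nat (Suc n) powr - w) sums zeta w"
proof -
  assume w: "Re w > 1"
  have le: "norm (of_nat (Suc n) powr - s :: complex) \<le> 1 * real (Suc n) powr (- (Re s - 1) - 1)" for n s
    using norm_powr_real_powr[of "of_nat (Suc n)" "- s"] by simp
  have hol: "(\<lambda>s. of_nat (Suc n) powr - s :: complex) holomorphic_on {s. Re s > 1}" for n
    by (intro holomorphic_intros) (auto simp: complex_nonpos_Reals_iff)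
  have "summable (\<lambda>n. of_nat (Suc n) powr - w :: complex)"
    by (rule holomorphic_on_suminf_halfplane(2)[where C = "\<lambda>_. 1", OF hol _ le w]) auto
  moreover have "zeta w = (\<Sum>n. of_nat (Suc n) powr - w)"
    using zeta_spec_zeta w unfolding zeta_spec_def by blast
  ultimately show ?thesis by (metis summable_sums)
qed

lemma zeta_euler_maclaurin_Re_gt_1:
  assumes "Re w > 1"
  shows "(w - 1) * zeta w = zeta_main w + zeta_remainder w"
proof -
  have "(\<lambda>n. of_nat (n + 4) powr - w) sums (zeta w - (\<Sum>n<3. of_nat (Suc n) powr - w))"
    using sums_split_initial_segment[OF zeta_sums[OF assms], of 3] by (simp add: eval_nat_numeral)
  hence "(\<lambda>n. (w - 1) * of_nat (n + 4) powr - w) sums ((w - 1) * (zeta w - (1 + 2 powr - w + 3 powr - w)))"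
    by (intro sums_mult) (simp add: eval_nat_numeral add_ac)
  moreover have lim: "(\<lambda>n. em_boundary (n + 4) w) \<longlonglongrightarrow> 0"
  proof -
    have f: "filterlim (\<lambda>n::nat. n + 4) at_top sequentially"
      by (rule filterlim_add_const_nat_at_top)
    have "(\<lambda>n. em_boundary (n + 4) w) \<longlonglongrightarrow> 0 + (w - 1) / 2 * 0 + (w - 1) * w / 12 * 0"
      unfolding em_boundary_def
      by (intro tendsto_intros tendsto_neg_powr_complex_of_nat[OF f]) (use assms in auto)
    thus ?thesis by simp
  qed
  ultimately have "(\<lambda>n. (w - 1) * of_nat (n + 4) powr - w + (em_boundary (Suc n + 4) w - em_boundary (n + 4) w))
      sums ((w - 1) * (zeta w - (1 + 2 powr - w + 3 powr - w)) + (0 - em_boundary (0 + 4) w))"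
    by (intro sums_add telescope_sums)
  hence "(\<lambda>n. em_error (n + 4) w) sums ((w - 1) * zeta w - zeta_main w)"
    by (simp add: em_error_def zeta_main_def algebra_simps)
  thus ?thesis unfolding zeta_remainder_def by (simp add: sums_unique[symmetric])
qed

lemma zeta_euler_maclaurin:
  assumes "Re w > -3" "w \<noteq> 1"
  shows "(w - 1) * zeta w = zeta_main w + zeta_remainder w"
proof (rule analytic_continuation_open[of "{w. Re w > 1}" "{w. Re w > -3} - {1}"
      "\<lambda>w. (w - 1) * zeta w" "\<lambda>w. zeta_main w + zeta_remainder w"])
  show "{w. Re w > 1} \<noteq> {}" by (auto intro: exI[of _ 2])
  show "connected ({w. Re w > -3} - {1})"
    by (intro connected_open_delete convex_connected convex_halfspace_Re_gt open_halfspace_Re_gt) auto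
  show "(\<lambda>w. (w - 1) * zeta w) holomorphic_on {w. Re w > -3} - {1}"
    using zeta_spec_zeta unfolding zeta_spec_def
    by (intro holomorphic_intros) (auto elim: holomorphic_on_subset)
  show "(\<lambda>w. zeta_main w + zeta_remainder w) holomorphic_on {w. Re w > -3} - {1}"
    by (intro holomorphic_intros holomorphic_zeta_main holomorphic_on_subset[OF holomorphic_zeta_remainder]) auto
qed (use assms in \<open>auto simp: open_halfspace_Re_gt zeta_euler_maclaurin_Re_gt_1\<close>)

text \<open>
  The right-hand side is holomorphic at 1 as well, so it is the continuation that removes the singularity.
\<close>
lemma remove_sings_zeta_euler_maclaurin:
  assumes "Re w > -3"
  shows "remove_sings (\<lambda>z. (z - 1) * zeta z) w = zeta_main w + zeta_remainder w"
proof (rule remove_sings_eqI)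
  let ?G = "\<lambda>w. zeta_main w + zeta_remainder w"
  have "?G holomorphic_on {w. Re w > -3}"
    by (intro holomorphic_intros holomorphic_zeta_main holomorphic_zeta_remainder)
  hence "isCont ?G w"
    using assms holomorphic_on_imp_continuous_on continuous_on_eq_continuous_at open_halfspace_Re_gt by blast
  hence "?G \<midarrow>w\<rightarrow> ?G w" by (simp add: isCont_def)
  moreover have "eventually (\<lambda>z. (z - 1) * zeta z = ?G z) (at w)"
  proof -
    have "eventually (\<lambda>z. z \<in> {z. Re z > -3} \<and> z \<noteq> 1) (at w)"
      using assms by (intro eventually_conj eventually_at_in_open' eventually_neq_at_within open_halfspace_Re_gt) auto
    thus ?thesis by eventually_elim (use zeta_euler_maclaurin in auto)
  qed
  ultimately show "(\<lambda>z. (z - 1) * zeta z) \<midarrow>w\<rightarrow> ?G w"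
    by (simp add: filterlim_cong)
qed

text \<open>
  Dividing the Taylor series of \<open>(s - 1) * zeta s\<close> at 1 by \<open>s - 1\<close> yields the Laurent series of \<open>zeta\<close>, so the
  coefficient of \<open>s - 1\<close> in the latter is half of the second derivative.
\<close>
lemma stieltjes_1_eq:
  "stieltjes 1 = - Re ((deriv ^^ 2) (remove_sings (\<lambda>z. (z - 1) * zeta z)) 1) / 2"
proof -
  define F where "F = remove_sings (\<lambda>z. (z - 1) * zeta z)"
  have "(\<lambda>w. zeta_main w + zeta_remainder w) holomorphic_on {w. Re w > -3}"
    by (intro holomorphic_intros holomorphic_zeta_main holomorphic_zeta_remainder)
  hence hol: "F holomorphic_on {w. Re w > -3}"
    by (rule holomorphic_transform) (simp add: F_def remove_sings_zeta_euler_maclaurin)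
  hence "F analytic_on {1}"
    by (auto simp: analytic_at intro!: exI[of _ "{w. Re w > -3}"] open_halfspace_Re_gt)
  hence "(\<lambda>x. F (1 + x)) has_laurent_expansion fps_to_fls (fps_expansion F 1)"
    by (intro has_laurent_expansion_fps analytic_at_imp_has_fps_expansion)
  hence "(\<lambda>x. F (1 + x) * x powi (-1)) has_laurent_expansion fls_shift (- (-1)) (fps_to_fls (fps_expansion F 1))"
    by (intro laurent_expansion_intros)
  also have "?this \<longleftrightarrow> (\<lambda>x. zeta (1 + x)) has_laurent_expansion fls_shift 1 (fps_to_fls (fps_expansion F 1))"
  proof (intro has_laurent_expansion_cong)
    have "eventually (\<lambda>x::complex. x \<in> {x. Re x > -4}) (at 0)"
      by (intro eventually_at_in_open' open_halfspace_Re_gt) auto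
    moreover have "eventually (\<lambda>x::complex. x \<noteq> 0) (at 0)" by (rule eventually_neq_at_within)
    ultimately show "eventually (\<lambda>x. F (1 + x) * x powi -1 = zeta (1 + x)) (at 0)"
    proof eventually_elim
      case (elim x)
      hence "F (1 + x) = x * zeta (1 + x)"
        using zeta_euler_maclaurin[of "1 + x"] by (simp add: F_def remove_sings_zeta_euler_maclaurin)
      thus ?case using elim by (simp add: field_simps)
    qed
  qed simp
  finally have "laurent_expansion zeta 1 = fls_shift 1 (fps_to_fls (fps_expansion F 1))"
    by (rule laurent_expansion_eqI)
  thus ?thesis
    by (simp add: stieltjes_def fps_expansion_def F_def[symmetric] eval_nat_numeral)
qed

section \<open>Bounds for the derivatives of the remainder\<close>

lemma ln_2_bounds: "ln 2 \<in> {693147/1000000..693148/1000000::real}"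
  using ln_approx_bounds[of 2 6] by (simp add: eval_nat_numeral)

lemma ln_3_bounds: "ln 3 \<in> {1098611/1000000..1098613/1000000::real}"
  using ln_approx_bounds[of 3 9] by (simp add: eval_nat_numeral)

lemma ln_4_eq: "ln 4 = 2 * ln (2::real)"
  using ln_realpow[of 2 2] by simp

text \<open>
  The left-hand side is a polynomial of degree 5 in \<open>v = s - 1\<close> with nonnegative coefficients, and 240 times
  the Taylor polynomial of \<open>exp (1.38 * v)\<close> of degree 5 dominates it coefficient by coefficient; note \<open>1.38 < ln 4\<close>.
\<close>
lemma pochhammer_le_4_powr:
  assumes "s \<ge> 1"
  shows "s * (s + 1) * (s + 2) * (s + 3) * (s + 4) \<le> 240 * 4 powr (s - 1 :: real)"
proof -
  define v where "v = s - 1"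
  have v: "v \<ge> 0" using assms by (simp add: v_def)
  obtain t where "exp (138/100 * v) = (\<Sum>m<6. (138/100 * v) ^ m / fact m) + exp t / fact 6 * (138/100 * v) ^ 6"
    using Maclaurin_exp_le[of "138/100 * v" 6] by blast
  moreover have "exp t / fact 6 * (138/100 * v) ^ 6 \<ge> 0" by simp
  ultimately have "240 * (\<Sum>m<6. (138/100 * v) ^ m / fact m) \<le> 240 * exp (138/100 * v)" by simp
  also have "\<dots> \<le> 240 * exp (ln 4 * v)"
    using v ln_2_bounds by (intro mult_left_mono iffD2[OF exp_le_cancel_iff] mult_right_mono) (auto simp: ln_4_eq)
  finally have 1: "240 * (\<Sum>m<6. (138/100 * v) ^ m / fact m) \<le> 240 * 4 powr (s - 1)"
    by (simp add: powr_def v_def mult_ac)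
  have "s * (s + 1) * (s + 2) * (s + 3) * (s + 4) = 120 + 274 * v + 225 * v ^ 2 + 85 * v ^ 3 + 15 * v ^ 4 + v ^ 5"
    unfolding v_def by (simp add: algebra_simps eval_nat_numeral)
  also have "\<dots> \<le> 120 + 274 * v + 228 * v ^ 2 + 105 * v ^ 3 + 36 * v ^ 4 + 10 * v ^ 5"
    using v by (intro add_mono mult_right_mono) auto
  also have "\<dots> \<le> 240 * (\<Sum>m<6. (138/100 * v) ^ m / fact m)"
  proof -
    have "240 * (\<Sum>m<6. (138/100 * v) ^ m / fact m) = 240 + 1656/5 * v + 28566/125 * v ^ 2
        + 328509/3125 * v ^ 3 + 22667121/625000 * v ^ 4 + 1564031349/156250000 * v ^ 5"
      by (simp add: lessThan_nat_numeral fact_numeral power_mult_distrib power_divide algebra_simps)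
    moreover have "120 + 274 * v + 228 * v ^ 2 + 105 * v ^ 3 + 36 * v ^ 4 + 10 * v ^ 5 \<le> \<dots>"
      using v by (intro add_mono mult_right_mono) auto
    ultimately show ?thesis by simp
  qed
  also note 1
  finally show ?thesis .
qed

text \<open>
  The bound is the telescoping sum of the midpoint estimate
  \<open>x powr -4 \<le> integral of y powr -4 over {x - 1/2..x + 1/2}\<close>, which holds by convexity.
\<close>
lemma
  shows summable_inverse_4th_powers: "summable (\<lambda>n. 1 / (real n + 4) ^ 4)"
    and suminf_inverse_4th_powers_le: "(\<Sum>n. 1 / (real n + 4) ^ 4) \<le> 8 / 1029"
proof -
  define \<tau> where "\<tau> n = 1 / (3 * (real n + 7/2) ^ 3)" for n
  have "filterlim (\<lambda>n. 3 * (real n + 7/2) ^ 3) at_infinity sequentially" by real_asymp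
  hence "\<tau> \<longlonglongrightarrow> 0" unfolding \<tau>_def by (intro tendsto_divide_0[OF tendsto_const])
  from telescope_sums'[OF this] have \<tau>: "(\<lambda>n. \<tau> n - \<tau> (Suc n)) sums (8 / 1029)"
    by (simp add: \<tau>_def power3_eq_cube)
  have le: "1 / (real n + 4) ^ 4 \<le> \<tau> n - \<tau> (Suc n)" for n
  proof -
    define x where "x = real n + 4"
    have x: "x \<ge> 4" by (simp add: x_def)
    have "9 * x\<^sup>2 / 16 \<le> 5/2 * x ^ 4"
      using mult_mono[of 1 "x\<^sup>2" "x\<^sup>2" "x\<^sup>2"] x one_le_power[of x 2] by (simp add: eval_nat_numeral)
    hence *: "3 * ((x - 1/2) * (x + 1/2)) ^ 3 \<le> x ^ 4 * ((x + 1/2) ^ 3 - (x - 1/2) ^ 3)"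
      by (simp add: algebra_simps eval_nat_numeral)
    define a b where "a = x - 1/2" and "b = x + 1/2"
    have ab: "a > 0" "b > 0" using x by (simp_all add: a_def b_def)
    have "1 / x ^ 4 \<le> (b ^ 3 - a ^ 3) / (3 * (a * b) ^ 3)"
      using * ab x unfolding a_def[symmetric] b_def[symmetric] by (simp add: field_simps)
    also have "\<dots> = 1 / (3 * a ^ 3) - 1 / (3 * b ^ 3)"
      using ab by (simp add: power_mult_distrib field_simps)
    finally show ?thesis by (simp add: \<tau>_def x_def a_def b_def algebra_simps)
  qed
  show summ: "summable (\<lambda>n. 1 / (real n + 4) ^ 4)"
    by (rule summable_comparison_test'[OF sums_summable[OF \<tau>]]) (use le in auto)
  show "(\<Sum>n. 1 / (real n + 4) ^ 4) \<le> 8 / 1029"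
    using suminf_le[OF le summ sums_summable[OF \<tau>]] sums_unique[OF \<tau>] by simp
qed

text \<open>
  On the disc, the absolute value of every factor of \<open>(w - 1) * w * (w + 1) * (w + 2) * (w + 3)\<close> is at most its value at the rightmost
  point \<open>s + 1\<close>, and \<open>n powr (- Re w - 4)\<close> is at most its value at the leftmost point \<open>s - 1\<close>.  The resulting
  growth \<open>4 powr (s - 1)\<close> of the product is paid for by \<open>n powr (1 - s)\<close> with \<open>n \<ge> 4\<close>, so that the bound is
  uniform in \<open>s\<close>.
\<close>
lemma norm_zeta_remainder_le:
  assumes s: "s \<ge> 1" and w: "norm (w - complex_of_real s) \<le> 1"
  shows "norm (zeta_remainder w) \<le> 8 / 3087"
proof -
  have Re: "Re w \<ge> s - 1" using w abs_Re_le_cmod[of "w - of_real s"] by auto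
  have "norm (w + of_real k) \<le> s + k + 1" if "k \<ge> -1" for k
    using norm_triangle_ineq[of "w - of_real s" "of_real (s + k)"] w s that
    by (simp add: norm_of_real del: of_real_add) (simp add: of_real_add add_ac)
  from this[of "-1"] this[of 0] this[of 1] this[of 2] this[of 3]
  have "norm ((w - 1) * w * (w + 1) * (w + 2) * (w + 3)) \<le> s * (s + 1) * (s + 2) * (s + 3) * (s + 4)"
    unfolding norm_mult using s by (intro mult_mono) (auto simp: add_ac)
  also have "\<dots> \<le> 240 * 4 powr (s - 1)" by (rule pochhammer_le_4_powr[OF s])
  finally have P: "norm ((w - 1) * w * (w + 1) * (w + 2) * (w + 3)) \<le> 240 * 4 powr (s - 1)" .
  have le: "norm (em_error (n + 4) w) \<le> (1/3) * (1 / (real n + 4) ^ 4)" for n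
  proof -
    have "norm (em_error (n + 4) w)
        \<le> norm ((w - 1) * w * (w + 1) * (w + 2) * (w + 3)) / 720 * real (n + 4) powr (- Re w - 4)"
      using Re s by (intro norm_em_error_le) auto
    also have "\<dots> \<le> (240 * 4 powr (s - 1)) / 720 * (real (n + 4) powr (1 - s) * real (n + 4) powr (-4))"
      unfolding powr_add[symmetric] using P Re by (intro mult_mono divide_right_mono powr_mono) auto
    also have "\<dots> \<le> (240 * 4 powr (s - 1)) / 720 * (4 powr (1 - s) * real (n + 4) powr (-4))"
      using s by (intro mult_left_mono mult_right_mono powr_mono2') auto
    also have "\<dots> = (1/3) * (4 powr (s - 1) * 4 powr (1 - s)) * real (n + 4) powr (-4)" by simp
    also have "\<dots> = (1/3) * (1 / (real n + 4) ^ 4)"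
      by (simp flip: powr_add) (simp add: powr_minus powr_numeral field_simps)
    finally show ?thesis .
  qed
  have "norm (zeta_remainder w) \<le> (\<Sum>n. (1/3) * (1 / (real n + 4) ^ 4))"
    unfolding zeta_remainder_def
    by (rule norm_suminf_le[OF le summable_mult[OF summable_inverse_4th_powers]])
  also have "\<dots> \<le> 8 / 3087"
    using suminf_inverse_4th_powers_le by (subst suminf_mult[OF summable_inverse_4th_powers]) simp
  finally show ?thesis .
qed

lemma norm_higher_deriv_zeta_remainder_le:
  assumes s: "s \<ge> 1"
  shows "norm ((deriv ^^ k) zeta_remainder (complex_of_real s)) \<le> fact k * (8 / 3087)"
proof -
  have sub: "cball (complex_of_real s) 1 \<subseteq> {w. Re w > -3}"
  proof
    fix w assume "w \<in> cball (complex_of_real s) 1"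
    thus "w \<in> {w. Re w > -3}" using s abs_Re_le_cmod[of "of_real s - w"] by (auto simp: dist_norm)
  qed
  have "norm ((deriv ^^ k) zeta_remainder (complex_of_real s)) \<le> fact k * (8 / 3087) / 1 ^ k"
  proof (rule Cauchy_inequality)
    show "zeta_remainder holomorphic_on ball (complex_of_real s) 1"
      using sub ball_subset_cball by (intro holomorphic_on_subset[OF holomorphic_zeta_remainder]) blast
    show "continuous_on (cball (complex_of_real s) 1) zeta_remainder"
      using sub by (intro holomorphic_on_imp_continuous_on holomorphic_on_subset[OF holomorphic_zeta_remainder])
    show "norm (zeta_remainder x) \<le> 8 / 3087" if "norm (complex_of_real s - x) = 1" for x
      using that by (intro norm_zeta_remainder_le[OF s]) (simp add: norm_minus_commute)
  qed simp
  thus ?thesis by simp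
qed

section \<open>The derivatives of the main part\<close>

text \<open>
  The functions \<open>exp (- L * u) * (c0 + c1 * u + c2 * u\<^sup>2)\<close> for fixed \<open>L\<close> are closed under differentiation; with
  \<open>L\<close> equal to \<open>ln 2\<close>, \<open>ln 3\<close> and \<open>ln 4\<close> they make up the main part in terms of \<open>u = s - 1\<close>.  The argument type is
  generic because the functions are differentiated over the complex numbers and estimated over the reals.
\<close>
definition quad_exp :: "real \<Rightarrow> real \<Rightarrow> real \<Rightarrow> real \<Rightarrow> 'a \<Rightarrow> 'a::{real_normed_field,banach}" where
  "quad_exp L c0 c1 c2 u = exp (- of_real L * u) * (of_real c0 + of_real c1 * u + of_real c2 * u\<^sup>2)"

lemma has_field_derivative_quad_exp [derivative_intros]:
  "(quad_exp L c0 c1 c2 has_field_derivative quad_exp L (c1 - L * c0) (2 * c2 - L * c1) (- L * c2) u) (at u within A)"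
  unfolding quad_exp_def[abs_def]
  by (auto intro!: derivative_eq_intros simp: algebra_simps power2_eq_square)

lemma of_real_quad_exp: "of_real (quad_exp L c0 c1 c2 u) = quad_exp L c0 c1 c2 (of_real u)"
  by (simp add: quad_exp_def flip: exp_of_real)

text \<open>
  The second and third derivatives of the main part at \<open>1 + u\<close>.
\<close>
definition zeta_main_D2 :: "'a \<Rightarrow> 'a::{real_normed_field,banach}" where
  "zeta_main_D2 u = quad_exp (ln 2) (- ln 2) ((ln 2)\<^sup>2 / 2) 0 u
     + quad_exp (ln 3) (- 2 * ln 3 / 3) ((ln 3)\<^sup>2 / 3) 0 u
     + quad_exp (ln 4) ((ln 4)\<^sup>2 - 25 / 96 * ln 4 + 1 / 96)
         (25 / 192 * (ln 4)\<^sup>2 - ln 4 / 48) ((ln 4)\<^sup>2 / 192) u"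

definition zeta_main_D3 :: "'a \<Rightarrow> 'a::{real_normed_field,banach}" where
  "zeta_main_D3 u = quad_exp (ln 2) (3 / 2 * (ln 2)\<^sup>2) (- ((ln 2) ^ 3) / 2) 0 u
     + quad_exp (ln 3) ((ln 3)\<^sup>2) (- ((ln 3) ^ 3) / 3) 0 u
     + quad_exp (ln 4) (- ((ln 4) ^ 3) + 25 / 64 * (ln 4)\<^sup>2 - ln 4 / 32)
         (- 25 / 192 * (ln 4) ^ 3 + (ln 4)\<^sup>2 / 32) (- ((ln 4) ^ 3) / 192) u"

lemma has_field_derivative_zeta_main_D2 [derivative_intros]:
  "(zeta_main_D2 has_field_derivative zeta_main_D3 u) (at u within A)"
  unfolding zeta_main_D2_def[abs_def] zeta_main_D3_def
  by (rule derivative_eq_intros refl)+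
     (simp add: algebra_simps power2_eq_square power3_eq_cube)

lemma zeta_main_eq:
  "zeta_main w = (w - 1) + quad_exp (ln 2) 0 (1/2) 0 (w - 1) + quad_exp (ln 3) 0 (1/3) 0 (w - 1)
     + quad_exp (ln 4) 1 (25/192) (1/192) (w - 1)"
proof -
  have *: "exp (- of_real (ln (real n)) * (w - 1)) = of_nat n * of_nat n powr - w" if "n > 0" for n
  proof -
    have "exp (- of_real (ln (real n)) * (w - 1)) = of_nat n powr - w * exp (of_real (ln (real n)))"
      using that by (simp add: powr_def Ln_of_nat algebra_simps flip: exp_add)
    also have "exp (of_real (ln (real n)) :: complex) = of_real (exp (ln (real n)))"
      by (simp flip: exp_of_real)
    also have "\<dots> = of_nat n" using that by simp
    finally show ?thesis by (simp add: mult_ac)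
  qed
  have p: "(4::complex) powr (1 - w) = 4 * 4 powr (- w)" "(4::complex) powr (- w - 1) = 4 powr (- w) / 4"
    by (simp_all add: powr_diff powr_minus field_simps)
  note e = *[of 2, simplified] *[of 3, simplified] *[of 4, simplified]
  show ?thesis
    unfolding zeta_main_def em_boundary_def quad_exp_def of_nat_numeral p
    using e by (simp add: field_simps power2_eq_square)
qed

lemma higher_deriv_zeta_main:
  shows "(deriv ^^ 2) zeta_main = (\<lambda>w. zeta_main_D2 (w - 1))"
    and "(deriv ^^ 3) zeta_main = (\<lambda>w. zeta_main_D3 (w - 1))"
proof -
  let ?D1 = "\<lambda>u. 1 + quad_exp (ln 2) (1/2) (- ln 2 / 2) 0 u + quad_exp (ln 3) (1/3) (- ln 3 / 3) 0 u
     + quad_exp (ln 4) (25/192 - ln 4) (1/96 - 25/192 * ln 4) (- ln 4 / 192) (u :: complex)"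
  have shift: "((\<lambda>w. f (w - 1)) has_field_derivative f' (w - 1)) (at w)"
    if "\<And>u. (f has_field_derivative f' u) (at u)" for f f' :: "complex \<Rightarrow> complex" and w
    using that[of "w - 1"] DERIV_shift[of f "f' (w - 1)" w "-1"] by simp
  have "((\<lambda>u. u + quad_exp (ln 2) 0 (1/2) 0 u + quad_exp (ln 3) 0 (1/3) 0 u
     + quad_exp (ln 4) 1 (25/192) (1/192) u) has_field_derivative ?D1 u) (at u)" for u
    by (rule derivative_eq_intros refl)+ (simp add: algebra_simps)
  from shift[OF this] have "(zeta_main has_field_derivative ?D1 (w - 1)) (at w)" for w
    by (simp add: zeta_main_eq[abs_def])
  hence 1: "deriv zeta_main = (\<lambda>w. ?D1 (w - 1))" by (auto intro: DERIV_imp_deriv)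
  have "(?D1 has_field_derivative zeta_main_D2 u) (at u)" for u
    unfolding zeta_main_D2_def
    by (rule derivative_eq_intros refl)+ (simp add: algebra_simps power2_eq_square)
  from shift[OF this] have 2: "deriv (\<lambda>w. ?D1 (w - 1)) = (\<lambda>w. zeta_main_D2 (w - 1))"
    by (auto intro: DERIV_imp_deriv)
  have 3: "deriv (\<lambda>w::complex. zeta_main_D2 (w - 1)) = (\<lambda>w. zeta_main_D3 (w - 1))"
    by (intro ext DERIV_imp_deriv shift derivative_intros)
  show "(deriv ^^ 2) zeta_main = (\<lambda>w. zeta_main_D2 (w - 1))"
    and "(deriv ^^ 3) zeta_main = (\<lambda>w. zeta_main_D3 (w - 1))"
    by (simp_all only: numeral_2_eq_2 numeral_3_eq_3 funpow.simps comp_def id_def 1 2 3)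
qed

section \<open>Four polynomial inequalities\<close>

text \<open>
  Both sides agree at \<open>u = 0\<close> (with \<open>f = g\<close>), so the lower bound is a comparison of slopes.  After dividing
  by \<open>u\<close>, the claim \<open>g * c\<^sup>2 \<le> (g - k * u) * (c + g * u)\<^sup>2\<close> becomes \<open>h u \<ge> 0\<close> for a concave quadratic \<open>h\<close>,
  which only has to be checked at both ends of the interval.
\<close>
lemma lower_bound_near_1:
  fixes g c u f :: real
  assumes g: "g \<in> {1404/10000..1509/10000}" and c: "9/22 \<le> c" "c \<le> 14/33" and u: "0 \<le> u" "u \<le> 5/4"
    and f: "f \<ge> g - 546/10000 * u"
  shows "g * c\<^sup>2 / (c + g * u)\<^sup>2 \<le> f"
proof -
  define k where "k = (546/10000 :: real)"
  define h where "h u = g\<^sup>2 * (2 * c + g * u) - k * (c + g * u)\<^sup>2" for u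
  have g0: "g > 0" using g by simp
  have "h 0 = c * (2 * g\<^sup>2 - k * c)" by (simp add: h_def power2_eq_square algebra_simps)
  also have "2 * g\<^sup>2 \<ge> 2 * (1404/10000)\<^sup>2" using g by (intro mult_left_mono power_mono) auto
  hence "2 * g\<^sup>2 - k * c \<ge> 0" using c by (simp add: k_def power2_eq_square)
  hence "c * (2 * g\<^sup>2 - k * c) \<ge> 0" using c by simp
  finally have h0: "h 0 \<ge> 0" .
  \<comment> \<open>At this end \<open>h\<close> decreases in \<open>c\<close>, so the largest \<open>c\<close> is the worst case; there it increases in \<open>g\<close>.\<close>
  have h1: "h (5/4) \<ge> 0"
  proof -
    define e where "e = g - 1404/10000"
    have e: "e \<ge> 0" using g by (simp add: e_def)
    have "g * g \<le> 1509/10000 * (1509/10000)" using g by (intro mult_mono) auto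
    hence "0 \<le> (14/33 - c) * (k * (c + 14/33 + 5/2 * g) - 2 * g\<^sup>2)"
      using g c by (intro mult_nonneg_nonneg) (auto simp: k_def power2_eq_square)
    moreover have "0 \<le> g\<^sup>2 * (28/33 + 5/4 * g) - k * (14/33 + 5/4 * g)\<^sup>2"
    proof -
      have "g = e + 1404/10000" by (simp add: e_def)
      moreover have "0 \<le> e * e" "0 \<le> e * (e * e)" using e by simp_all
      ultimately show ?thesis using e by (simp add: k_def power2_eq_square algebra_simps)
    qed
    moreover have "h (5/4) = (14/33 - c) * (k * (c + 14/33 + 5/2 * g) - 2 * g\<^sup>2)
        + (g\<^sup>2 * (28/33 + 5/4 * g) - k * (14/33 + 5/4 * g)\<^sup>2)"
      by (simp add: h_def power2_eq_square field_simps)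
    ultimately show ?thesis by simp
  qed
  have "h u = (1 - 4/5 * u) * h 0 + (4/5 * u) * h (5/4) + k * g\<^sup>2 * (u * (5/4 - u))"
    by (simp add: h_def power2_eq_square algebra_simps)
  also have "\<dots> \<ge> 0" using u h0 h1 by (intro add_nonneg_nonneg mult_nonneg_nonneg) (auto simp: k_def)
  finally have "u * h u \<ge> 0" using u by simp
  hence "g * c\<^sup>2 \<le> (g - k * u) * (c + g * u)\<^sup>2"
    by (simp add: h_def power2_eq_square algebra_simps)
  also have "\<dots> \<le> f * (c + g * u)\<^sup>2" using f by (intro mult_right_mono) (auto simp: k_def)
  finally have "g * c\<^sup>2 \<le> f * (c + g * u)\<^sup>2" .
  moreover have "(c + g * u)\<^sup>2 > 0" using c g0 u by (intro zero_less_power add_pos_nonneg) auto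
  ultimately show ?thesis by (simp only: pos_divide_le_eq)
qed

text \<open>
  The left-hand side equals \<open>g / (1 + (g / c) * u)\<^sup>2\<close>, which is at most \<open>0.1509 / (1 + 0.33 * u)\<^sup>2\<close>; comparing
  this with the linear lower bound of \<open>f\<close> leaves a cubic polynomial in \<open>u\<close>.
\<close>
lemma lower_bound_away_from_1:
  fixes g c u f :: real
  assumes g: "g \<in> {1404/10000..1509/10000}" and c: "0 < c" "c \<le> 14/33" and u: "5/4 \<le> u" "u \<le> 3"
    and f: "f \<ge> 971/10000 - 15/1000 * u"
  shows "g * c\<^sup>2 / (c + g * u)\<^sup>2 \<le> f"
proof -
  have "33/100 * c \<le> g" using g c by simp
  hence "33/100 * c * u \<le> g * u" using u by (intro mult_right_mono) auto
  hence "(c * (1 + 33/100 * u))\<^sup>2 \<le> (c + g * u)\<^sup>2"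
    using c u by (intro power_mono) (auto simp: algebra_simps)
  moreover have "1509/10000 \<le> (971/10000 - 15/1000 * u) * (1 + 33/100 * u)\<^sup>2"
  proof -
    define t where "t = u - 5/4"
    have t: "0 \<le> t" "t \<le> 7/4" and u_eq: "u = t + 5/4" using u by (simp_all add: t_def)
    have p: "t ^ 2 \<le> 7/4 * t" "t ^ 3 \<le> 7/4 * t ^ 2"
      using mult_right_mono[OF t(2), of t] mult_right_mono[OF t(2), of "t ^ 2"] t
      by (simp_all add: eval_nat_numeral)
    have "(971/10000 - 15/1000 * u) * (1 + 33/100 * u)\<^sup>2
        = (20009023/128000000) + (6898311/160000000) * t + (-1090287/200000000) * t ^ 2
          + (-3267/2000000) * t ^ 3"
      unfolding u_eq by (simp add: field_simps eval_nat_numeral)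
    thus ?thesis using t p by linarith
  qed
  hence "g * c\<^sup>2 \<le> ((971/10000 - 15/1000 * u) * (1 + 33/100 * u)\<^sup>2) * c\<^sup>2"
    using g by (intro mult_right_mono) auto
  hence "g * c\<^sup>2 \<le> (971/10000 - 15/1000 * u) * (c * (1 + 33/100 * u))\<^sup>2"
    by (simp add: power_mult_distrib mult_ac)
  ultimately have "g * c\<^sup>2 \<le> (971/10000 - 15/1000 * u) * (c + g * u)\<^sup>2"
    using u by (elim order_trans) (intro mult_left_mono, auto)
  also have "\<dots> \<le> f * (c + g * u)\<^sup>2" using f by (intro mult_right_mono) auto
  finally have "g * c\<^sup>2 \<le> f * (c + g * u)\<^sup>2" .
  moreover have "(c + g * u)\<^sup>2 > 0" using c g u by (intro zero_less_power add_pos_nonneg) auto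
  ultimately show ?thesis by (simp only: pos_divide_le_eq)
qed

text \<open>
  The numerator has the slope \<open>c / 4\<close> at \<open>u = 0\<close>, about 0.1, whereas \<open>f\<close> hardly exceeds \<open>g\<close>.  This leaves ample
  room for the quadratic terms.
\<close>
lemma upper_bound_near_1:
  fixes g c u f :: real
  assumes g: "0 \<le> g" "g \<le> 1509/10000" and c: "c \<ge> 9/22" and u: "0 \<le> u" "u \<le> 5/4"
    and f: "f \<le> g + 6/10000 * u"
  shows "f \<le> (g + c * u / 4 - g * u\<^sup>2 / 8) / (1 + u\<^sup>2 / 8)\<^sup>2"
proof -
  have "g * u \<le> 1509/10000 * (5/4)"
    by (rule mult_mono) (use g u in auto)
  moreover have "g * u ^ 3 \<le> 1509/10000 * (5/4) ^ 3"
    by (intro mult_mono power_mono) (use g u in auto)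
  moreover have "(1 + u\<^sup>2 / 8)\<^sup>2 \<le> (1 + (5/4)\<^sup>2 / 8)\<^sup>2"
    using u by (intro power_mono add_mono divide_right_mono) auto
  ultimately have "0 \<le> c / 4 - 3/8 * (g * u) - g * u ^ 3 / 64 - 6/10000 * (1 + u\<^sup>2 / 8)\<^sup>2"
    using c by (simp add: power_divide)
  hence "0 \<le> u * (c / 4 - 3/8 * (g * u) - g * u ^ 3 / 64 - 6/10000 * (1 + u\<^sup>2 / 8)\<^sup>2)"
    using u by simp
  hence "(g + 6/10000 * u) * (1 + u\<^sup>2 / 8)\<^sup>2 \<le> g + c * u / 4 - g * u\<^sup>2 / 8"
    by (simp add: algebra_simps eval_nat_numeral)
  moreover have "f * (1 + u\<^sup>2 / 8)\<^sup>2 \<le> (g + 6/10000 * u) * (1 + u\<^sup>2 / 8)\<^sup>2"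
    using f by (intro mult_right_mono) auto
  moreover have "(1 + u\<^sup>2 / 8)\<^sup>2 > 0"
    by (intro zero_less_power add_pos_nonneg) auto
  ultimately show ?thesis by (simp only: pos_le_divide_eq)
qed

text \<open>
  The coefficient \<open>1 - u\<^sup>2 / 8\<close> of \<open>g\<close> in the numerator is at least \<open>- 1 / 8\<close>, so \<open>g\<close> can be replaced by
  its lower bound at the expense of the small constant \<open>0.0105 / 8\<close>.  What remains is a
  polynomial of degree 5 in \<open>t = 3 - u\<close>, with a positive constant term that represents the narrow gap at \<open>u = 3\<close>.
\<close>
lemma upper_bound_away_from_1:
  fixes g c u f :: real
  assumes g: "g \<in> {1404/10000..1509/10000}" and c: "c \<ge> 9/22" and u: "5/4 \<le> u" "u \<le> 3"
    and f: "f \<le> 626/10000 + 39/1000 * (3 - u)"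
  shows "f \<le> (g + c * u / 4 - g * u\<^sup>2 / 8) / (1 + u\<^sup>2 / 8)\<^sup>2"
proof -
  define t where "t = 3 - u"
  have t: "0 \<le> t" "t \<le> 7/4" and u_eq: "u = 3 - t" using u by (simp_all add: t_def)
  have p: "t ^ 2 \<le> 7/4 * t" "t ^ 3 \<le> 7/4 * t ^ 2" "t ^ 5 \<le> 7/4 * t ^ 4"
    using mult_right_mono[OF t(2), of t] mult_right_mono[OF t(2), of "t ^ 2"] mult_right_mono[OF t(2), of "t ^ 4"] t
    by (simp_all add: eval_nat_numeral)
  \<comment> \<open>The cubic term of the final polynomial is negative; this square lets the quartic term compensate it.\<close>
  have "0 \<le> (t * (t - 1))\<^sup>2" by simp
  hence p4: "2 * t ^ 3 - t ^ 2 \<le> t ^ 4" by (simp add: algebra_simps eval_nat_numeral)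
  have "(626/10000 + 39/1000 * t) * (1 + u\<^sup>2 / 8)\<^sup>2
      \<le> 1404/10000 * (1 - u\<^sup>2 / 8) - 105/10000 * (1/8) + 9/88 * u"
  proof -
    have "1404/10000 * (1 - u\<^sup>2 / 8) - 105/10000 * (1/8) + 9/88 * u - (626/10000 + 39/1000 * t) * (1 + u\<^sup>2 / 8)\<^sup>2
        = (18577/3520000) + (93123/3520000) * t + (6127/160000) * t ^ 2
          + (-4947/160000) * t ^ 3 + (2027/320000) * t ^ 4 + (-39/64000) * t ^ 5"
      unfolding u_eq by (simp add: field_simps eval_nat_numeral)
    also have "\<dots> \<ge> 0" using t p p4 by linarith
    finally show ?thesis by simp
  qed
  also have "\<dots> \<le> g + c * u / 4 - g * u\<^sup>2 / 8"
  proof -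
    have "0 \<le> (g - 1404/10000) * (9 - u\<^sup>2)"
      using g u power_mono[of u 3 2] by (intro mult_nonneg_nonneg) auto
    hence "g * u\<^sup>2 - 1404/10000 * u\<^sup>2 \<le> 9 * g - 9 * (1404/10000)"
      by (simp add: field_simps)
    moreover have "9/22 * u \<le> c * u" using c u by (intro mult_right_mono) auto
    moreover have "g \<le> 1509/10000" using g by simp
    ultimately show ?thesis by (simp add: field_simps)
  qed
  finally have "(626/10000 + 39/1000 * t) * (1 + u\<^sup>2 / 8)\<^sup>2 \<le> g + c * u / 4 - g * u\<^sup>2 / 8" .
  moreover have "f * (1 + u\<^sup>2 / 8)\<^sup>2 \<le> (626/10000 + 39/1000 * t) * (1 + u\<^sup>2 / 8)\<^sup>2"
    using f by (intro mult_right_mono) (auto simp: t_def)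
  moreover have "(1 + u\<^sup>2 / 8)\<^sup>2 > 0"
    by (intro zero_less_power add_pos_nonneg) auto
  ultimately show ?thesis by (simp only: pos_le_divide_eq)
qed

section \<open>The second derivative on the real axis\<close>

text \<open>
  Along the real axis the imaginary part of \<open>f\<close> is constantly 0, and the imaginary part of the complex
  derivative is its derivative.
\<close>
lemma deriv_in_Reals_halfplane:
  assumes hol: "f holomorphic_on {w. Re w > a}" and real: "\<And>x. x > a \<Longrightarrow> f (complex_of_real x) \<in> \<real>"
    and x: "x > a"
  shows "deriv f (complex_of_real x) \<in> \<real>"
proof -
  have "(f has_field_derivative deriv f (of_real x)) (at (of_real x))"
    using x by (intro holomorphic_derivI[OF hol open_halfspace_Re_gt]) auto
  hence "((\<lambda>x. f (of_real x)) has_vector_derivative deriv f (of_real x)) (at x)"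
    by (rule has_vector_derivative_real_field)
  from bounded_linear.has_vector_derivative[OF bounded_linear_Im this]
  have "((\<lambda>x. Im (f (of_real x))) has_real_derivative Im (deriv f (of_real x))) (at x)"
    by (simp add: has_real_derivative_iff_has_vector_derivative)
  moreover have "((\<lambda>x. Im (f (of_real x))) has_real_derivative 0) (at x)"
    by (rule has_field_derivative_transform_within_open[of "\<lambda>_. 0" _ _ "{a<..}"])
       (use x real in \<open>auto simp: complex_is_Real_iff\<close>)
  ultimately have "Im (deriv f (of_real x)) = 0" by (rule DERIV_unique)
  thus ?thesis by (simp add: complex_is_Real_iff)
qed

lemma zeta_remainder_in_Reals:
  assumes "x > -3"
  shows "zeta_remainder (complex_of_real x) \<in> \<real>"
proof -
  have powr: "of_nat n powr complex_of_real y \<in> \<real>" for n y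
    using powr_of_real[of "real n" y] by (metis Reals_of_real of_nat_0_le_iff of_real_of_nat_eq)
  have "em_error n (complex_of_real x) \<in> \<real>" for n
    using powr[of n "- x"] powr[of n "1 - x"] powr[of n "- x - 1"]
      powr[of "Suc n" "- x"] powr[of "Suc n" "1 - x"] powr[of "Suc n" "- x - 1"]
    unfolding em_error_def em_boundary_def
    by (intro Reals_add Reals_diff Reals_mult Reals_divide) simp_all
  hence "Im (em_error n (complex_of_real x)) = 0" for n by (simp add: complex_is_Real_iff)
  moreover have "Im (zeta_remainder (of_real x)) = (\<Sum>n. Im (em_error (n + 4) (of_real x)))"
    unfolding zeta_remainder_def using assms
    by (intro bounded_linear.suminf[OF bounded_linear_Im] summable_em_error) simp
  ultimately show ?thesis by (simp add: complex_is_Real_iff)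
qed

lemma higher_deriv_2_remove_sings_zeta:
  assumes "s \<ge> 1"
  shows "(deriv ^^ 2) (remove_sings (\<lambda>z. (z - 1) * zeta z)) (complex_of_real s)
       = of_real (zeta_main_D2 (s - 1) + Re ((deriv ^^ 2) zeta_remainder (of_real s)))"
proof -
  let ?S = "{w. Re w > -3}"
  have s: "complex_of_real s \<in> ?S" using assms by simp
  have G: "(\<lambda>w. zeta_main w + zeta_remainder w) holomorphic_on ?S"
    by (intro holomorphic_intros holomorphic_zeta_main holomorphic_zeta_remainder)
  have "(deriv ^^ 2) (remove_sings (\<lambda>z. (z - 1) * zeta z)) (of_real s)
      = (deriv ^^ 2) (\<lambda>w. zeta_main w + zeta_remainder w) (of_real s)"
    by (rule higher_deriv_transform_within_open[OF holomorphic_transform[OF G] G open_halfspace_Re_gt s])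
       (simp_all add: remove_sings_zeta_euler_maclaurin)
  also have "\<dots> = (deriv ^^ 2) zeta_main (of_real s) + (deriv ^^ 2) zeta_remainder (of_real s)"
    by (rule higher_deriv_add[OF holomorphic_zeta_main holomorphic_zeta_remainder open_halfspace_Re_gt s])
  also have "(deriv ^^ 2) zeta_main (complex_of_real s) = of_real (zeta_main_D2 (s - 1))"
    by (simp add: higher_deriv_zeta_main zeta_main_D2_def of_real_quad_exp)
  also have "(deriv ^^ 2) zeta_remainder (of_real s) \<in> \<real>"
  proof -
    note hol = holomorphic_zeta_remainder
    have "deriv zeta_remainder holomorphic_on ?S" by (rule holomorphic_deriv[OF hol open_halfspace_Re_gt])
    from deriv_in_Reals_halfplane[OF this deriv_in_Reals_halfplane[OF hol zeta_remainder_in_Reals], of s] assms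
    show ?thesis by (simp add: numeral_2_eq_2)
  qed
  hence "(deriv ^^ 2) zeta_remainder (of_real s) = of_real (Re ((deriv ^^ 2) zeta_remainder (of_real s)))"
    by (simp add: of_real_Re)
  finally show ?thesis by simp
qed

lemma higher_deriv_2_zeta_remainder_difference:
  assumes "s \<ge> 1"
  shows "\<bar>Re ((deriv ^^ 2) zeta_remainder (of_real s)) - Re ((deriv ^^ 2) zeta_remainder 1)\<bar> \<le> 48/3087 * (s - 1)"
proof -
  let ?R = "\<lambda>k. (deriv ^^ k) zeta_remainder"
  have "norm (?R 2 (of_real s) - ?R 2 (of_real 1)) \<le> 48/3087 * norm (complex_of_real s - of_real 1)"
  proof (rule field_differentiable_bound[of "closed_segment (of_real 1) (of_real s)"])
    fix z assume "z \<in> closed_segment (complex_of_real 1) (of_real s)"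
    then obtain x where x: "z = of_real x" "x \<ge> 1"
      using assms unfolding closed_segment_of_real by (auto simp: closed_segment_eq_real_ivl)
    have "(?R 2 has_field_derivative ?R (Suc 2) z) (at z)"
      by (rule has_field_derivative_higher_deriv[OF holomorphic_zeta_remainder open_halfspace_Re_gt])
         (use x in simp)
    thus "(?R 2 has_field_derivative ?R (Suc 2) z) (at z within closed_segment (of_real 1) (of_real s))"
      by (rule has_field_derivative_at_within)
    show "norm (?R (Suc 2) z) \<le> 48/3087"
      using norm_higher_deriv_zeta_remainder_le[OF x(2), of 3] x by (simp add: fact_numeral eval_nat_numeral)
  qed auto
  also have "norm (complex_of_real s - of_real 1) = s - 1"
    using assms by (simp del: of_real_diff of_real_1 flip: of_real_diff)
  finally show ?thesis
    using abs_Re_le_cmod[of "?R 2 (of_real s) - ?R 2 (of_real 1)"] by simp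
qed

lemma ln_2_power_bounds: "ln 2 ^ k \<in> {(693147/1000000) ^ k..(693148/1000000 :: real) ^ k}"
  using ln_2_bounds by (auto intro!: power_mono)

lemma ln_3_power_bounds: "ln 3 ^ k \<in> {(1098611/1000000) ^ k..(1098613/1000000 :: real) ^ k}"
  using ln_3_bounds by (auto intro!: power_mono)

lemma ln_2_square_bounds: "(ln 2)\<^sup>2 \<in> {480452/1000000..480455/1000000::real}"
  using ln_2_power_bounds[of 2] by (auto simp: power_divide)

lemma ln_2_cube_bounds: "(ln 2) ^ 3 \<in> {333023/1000000..333027/1000000::real}"
  using ln_2_power_bounds[of 3] by (auto simp: power_divide)

lemma ln_3_square_bounds: "(ln 3)\<^sup>2 \<in> {1206946/1000000..1206951/1000000::real}"
  using ln_3_power_bounds[of 2] by (auto simp: power_divide)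

lemma ln_3_cube_bounds: "(ln 3) ^ 3 \<in> {1325964/1000000..1325973/1000000::real}"
  using ln_3_power_bounds[of 3] by (auto simp: power_divide)

lemma exp_neg_ln_shift:
  assumes "n > 0"
  shows "exp (- ln (real n) * (real k + t)) = exp (- ln (real n) * t) / real n ^ k"
proof -
  have "exp (- ln (real n) * (real k + t)) = exp (- ln (real n) * t) / exp (real k * ln (real n))"
    by (simp add: algebra_simps flip: exp_diff)
  also have "exp (real k * ln (real n)) = real n ^ k"
    using assms by (simp add: exp_of_nat_mult)
  finally show ?thesis .
qed

lemma zeta_main_D2_0_bounds: "zeta_main_D2 (0 :: real) \<in> {1456/10000..1457/10000}"
  using ln_2_bounds ln_2_square_bounds ln_3_bounds ln_3_square_bounds
  by (simp add: zeta_main_D2_def quad_exp_def ln_4_eq power_mult_distrib)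

lemma zeta_main_D2_3_bounds: "zeta_main_D2 (3 :: real) \<in> {573/10000..574/10000}"
proof -
  have e: "exp (- ln 2 * 3) = (1/8 :: real)" "exp (- ln 3 * 3) = (1/27 :: real)" "exp (- ln 4 * 3) = (1/64 :: real)"
    using exp_neg_ln_shift[of 2 3 0] exp_neg_ln_shift[of 3 3 0] exp_neg_ln_shift[of 4 3 0] by simp_all
  show ?thesis
    unfolding zeta_main_D2_def quad_exp_def of_real_eq_id id_apply e
    unfolding ln_4_eq power_mult_distrib
    using ln_2_bounds ln_2_square_bounds ln_3_bounds ln_3_square_bounds by (simp add: field_simps)
qed

lemma zeta_main_D2_difference:
  fixes u v :: real
  assumes D3: "\<And>u :: real. u \<in> {0..3} \<Longrightarrow> zeta_main_D3 u \<in> {-39/1000..-15/1000}"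
    and "0 \<le> v" "v \<le> u" "u \<le> 3"
  shows "zeta_main_D2 u - zeta_main_D2 v \<in> {-39/1000 * (u - v)..-15/1000 * (u - v)}"
proof (cases "u = v")
  case False
  hence "v < u" using assms by simp
  from MVT2[OF this has_field_derivative_zeta_main_D2]
  obtain z where z: "v < z" "z < u" "zeta_main_D2 u - zeta_main_D2 v = (u - v) * zeta_main_D3 z" by blast
  have "zeta_main_D3 z \<in> {-39/1000..-15/1000}" using z assms by (intro D3) auto
  thus ?thesis
    using z(3) mult_left_mono[of "-39/1000" "zeta_main_D3 z" "u - v"]
      mult_left_mono[of "zeta_main_D3 z" "-15/1000" "u - v"] \<open>v < u\<close> by (simp add: mult.commute)
qed simp

text \<open>
  Apart from the values of its second derivative at both ends of the interval, the main part enters only through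
  the bounds for its third derivative.  They are kept as a hypothesis, to separate the argument from the
  computation that establishes them.
\<close>
lemma second_derivative_bounds:
  fixes s :: real
  assumes "s \<in> {1..4}" and D3: "\<And>u :: real. u \<in> {0..3} \<Longrightarrow> zeta_main_D3 u \<in> {-39/1000..-15/1000}"
  shows "let \<gamma> = euler_mascheroni;
             \<gamma>\<^sub>1 = stieltjes 1;
             D2 = (deriv ^^ 2) (remove_sings (\<lambda>z. (z - 1) * zeta z)) (of_real s)
         in D2 \<in> \<real> \<and>
            (- 2 * \<gamma>\<^sub>1 * (1 - \<gamma>)\<^sup>2) / (1 - \<gamma> - 2 * \<gamma>\<^sub>1 * (s - 1))\<^sup>2 \<le> Re D2 \<and>
            Re D2 \<le> - ((2 * \<gamma>\<^sub>1 - 1 / 4 * (1 - \<gamma>) * (s - 1) - 1 / 4 * \<gamma>\<^sub>1 * (s - 1)\<^sup>2)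
                       / (1 + 1 / 8 * (s - 1)\<^sup>2)\<^sup>2)"
proof -
  define R where "R s = Re ((deriv ^^ 2) zeta_remainder (complex_of_real s))" for s
  define f where "f = zeta_main_D2 (s - 1) + R s"
  define g where "g = - 2 * stieltjes 1"
  define c where "c = 1 - (euler_mascheroni :: real)"
  define u where "u = s - 1"
  have u: "0 \<le> u" "u \<le> 3" using assms(1) by (auto simp: u_def)
  have D2: "(deriv ^^ 2) (remove_sings (\<lambda>z. (z - 1) * zeta z)) (of_real s) = of_real f"
    using higher_deriv_2_remove_sings_zeta[of s] assms(1) by (simp add: f_def R_def)
  have g_eq: "g = zeta_main_D2 0 + R 1"
    unfolding g_def R_def stieltjes_1_eq using higher_deriv_2_remove_sings_zeta[of 1] by simp
  have R: "\<bar>R x\<bar> \<le> 16/3087" if "x \<ge> 1" for x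
    using norm_higher_deriv_zeta_remainder_le[OF that, of 2]
      abs_Re_le_cmod[of "(deriv ^^ 2) zeta_remainder (complex_of_real x)"] by (simp add: R_def)
  have R': "\<bar>R s - R 1\<bar> \<le> 48/3087 * u"
    using higher_deriv_2_zeta_remainder_difference[of s] assms(1) by (simp add: R_def u_def)
  have g: "g \<in> {1404/10000..1509/10000}"
    using g_eq R[of 1] zeta_main_D2_0_bounds by (auto simp: abs_le_iff)
  have c: "9/22 \<le> c" "c \<le> 14/33"
    using euler_mascheroni_gt_19_over_33 euler_mascheroni_less_13_over_22 by (auto simp: c_def)
  have f: "f - g = (zeta_main_D2 u - zeta_main_D2 0) + (R s - R 1)"
    by (simp add: f_def g_eq u_def)
  have "g * c\<^sup>2 / (c + g * u)\<^sup>2 \<le> f \<and> f \<le> (g + c * u / 4 - g * u\<^sup>2 / 8) / (1 + u\<^sup>2 / 8)\<^sup>2"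
  proof (cases "u \<le> 5/4")
    case True
    \<comment> \<open>As the bounds are attained at \<open>u = 0\<close>, \<open>f\<close> is compared with \<open>g\<close> itself, through the third derivative:
      \<open>0.039 + 48/3087 < 0.0546\<close> and \<open>- 0.015 + 48/3087 < 0.0006\<close>.\<close>
    have "zeta_main_D2 u - zeta_main_D2 0 \<in> {-39/1000 * u..-15/1000 * u}"
      using zeta_main_D2_difference[OF D3, of 0 u] u by simp
    hence "f \<ge> g - 546/10000 * u" "f \<le> g + 6/10000 * u"
      using f R' u(1) unfolding atLeastAtMost_iff abs_le_iff by linarith+
    thus ?thesis
      using True u g c lower_bound_near_1[of g c u f] upper_bound_near_1[of g c u f] by auto
  next
    case False
    \<comment> \<open>Here \<open>f\<close> is estimated from the value of the main part at \<open>u = 3\<close>, where the gap to the upper bound is narrow.\<close>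
    have "R s \<in> {-16/3087..16/3087}" using R[of s] assms(1) by auto
    moreover have "zeta_main_D2 3 - zeta_main_D2 u \<in> {39/1000 * u - 117/1000..15/1000 * u - 45/1000}"
      using zeta_main_D2_difference[OF D3, of u 3] u by (simp add: field_simps)
    moreover have "f = zeta_main_D2 u + R s" by (simp add: f_def u_def)
    ultimately have "f \<ge> 971/10000 - 15/1000 * u" "f \<le> 626/10000 + 39/1000 * (3 - u)"
      using zeta_main_D2_3_bounds by (auto simp: field_simps)
    thus ?thesis
      using False u g c lower_bound_away_from_1[of g c u f] upper_bound_away_from_1[of g c u f] by auto
  qed
  moreover have "- 2 * stieltjes 1 * (1 - euler_mascheroni)\<^sup>2 / (1 - euler_mascheroni - 2 * stieltjes 1 * (s - 1))\<^sup>2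
      = g * c\<^sup>2 / (c + g * u)\<^sup>2"
    by (simp add: g_def c_def u_def)
  moreover have "- ((2 * stieltjes 1 - 1 / 4 * (1 - euler_mascheroni) * (s - 1) - 1 / 4 * stieltjes 1 * (s - 1)\<^sup>2)
      / (1 + 1 / 8 * (s - 1)\<^sup>2)\<^sup>2) = (g + c * u / 4 - g * u\<^sup>2 / 8) / (1 + u\<^sup>2 / 8)\<^sup>2"
  proof -
    have "- (2 * stieltjes 1 - 1 / 4 * (1 - euler_mascheroni) * (s - 1) - 1 / 4 * stieltjes 1 * (s - 1)\<^sup>2)
        = g + c * u / 4 - g * u\<^sup>2 / 8"
      by (simp add: g_def c_def u_def)
    thus ?thesis unfolding minus_divide_left by (simp only: u_def) simp
  qed
  ultimately show ?thesis
    unfolding Let_def D2 by (simp only: Re_complex_of_real Reals_of_real simp_thms)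
qed

section \<open>Polynomial approximation of the third derivative of the main part\<close>

text \<open>
  The Taylor polynomial of degree 8 of \<open>exp (- L * t)\<close> has an error of at most 0.00022 for \<open>\<bar>t\<bar> \<le> 1\<close>.
  Rounding each of its 9 coefficients by at most 0.00001 adds at most 0.00009.
\<close>
lemma exp_neg_approx:
  fixes c :: "nat \<Rightarrow> real"
  assumes L: "0 \<le> l" "l \<le> L" "L \<le> h" "L \<le> ln 4" and t: "\<bar>t\<bar> \<le> 1"
    and c: "\<And>j. j < 9 \<Longrightarrow> c j - 1/100000 \<le> l ^ j / fact j \<and> h ^ j / fact j \<le> c j + 1/100000"
  shows "\<bar>exp (- L * t) - (\<Sum>j<9. c j * (- t) ^ j)\<bar> \<le> 31/100000"
proof -
  obtain \<xi> where \<xi>: "\<bar>\<xi>\<bar> \<le> \<bar>- L * t\<bar>"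
      "exp (- L * t) = (\<Sum>j<9. (- L * t) ^ j / fact j) + exp \<xi> / fact 9 * (- L * t) ^ 9"
    using Maclaurin_exp_le[of "- L * t" 9] by blast
  have Lt: "\<bar>- L * t\<bar> \<le> ln 4"
    using mult_mono[of L "ln 4" "\<bar>t\<bar>" 1] L t by (simp add: abs_mult)
  have "exp \<xi> \<le> exp (ln 4)" using \<xi>(1) Lt by (intro iffD2[OF exp_le_cancel_iff]) linarith
  hence "exp \<xi> \<le> 4" by simp
  moreover have "\<bar>- L * t\<bar> ^ 9 \<le> (1386296/1000000) ^ 9"
    using Lt ln_2_bounds by (intro power_mono) (auto simp: ln_4_eq)
  ultimately have "exp \<xi> * \<bar>- L * t\<bar> ^ 9 / fact 9 \<le> 4 * (1386296/1000000) ^ 9 / fact 9"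
    by (intro divide_right_mono mult_mono) auto
  also have "\<dots> \<le> 22/100000" by (simp add: fact_numeral power_divide)
  finally have rem: "\<bar>exp \<xi> / fact 9 * (- L * t) ^ 9\<bar> \<le> 22/100000"
    by (simp add: abs_mult power_abs)
  have "\<bar>(\<Sum>j<9. (- L * t) ^ j / fact j) - (\<Sum>j<9. c j * (- t) ^ j)\<bar>
      = \<bar>\<Sum>j<9. (L ^ j / fact j - c j) * (- t) ^ j\<bar>"
    unfolding sum_subtractf[symmetric]
    by (intro arg_cong[of _ _ abs] sum.cong) (simp_all add: power_mult_distrib[of L "- t", simplified] algebra_simps)
  also have "\<dots> \<le> (\<Sum>j<9. \<bar>(L ^ j / fact j - c j) * (- t) ^ j\<bar>)" by (rule sum_abs)
  also have "\<dots> \<le> (\<Sum>j<9::nat. 1/100000)"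
  proof (rule sum_mono)
    fix j :: nat assume "j \<in> {..<9}"
    hence j: "j < 9" by simp
    have "l ^ j / fact j \<le> L ^ j / fact j" "L ^ j / fact j \<le> h ^ j / fact j"
      using L by (auto intro!: divide_right_mono power_mono)
    with c[OF j] have "\<bar>L ^ j / fact j - c j\<bar> \<le> 1/100000" by linarith
    moreover have "\<bar>(- t) ^ j\<bar> \<le> 1" using t by (simp add: power_abs power_le_one)
    ultimately show "\<bar>(L ^ j / fact j - c j) * (- t) ^ j\<bar> \<le> 1/100000"
      using mult_mono[of "\<bar>L ^ j / fact j - c j\<bar>" "1/100000" "\<bar>(- t) ^ j\<bar>" 1] by (simp add: abs_mult)
  qed
  also have "\<dots> = 9/100000" by simp
  finally show ?thesis using \<xi>(2) rem by linarith
qed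

lemma less_9_cases: "j < 9 \<Longrightarrow> j \<in> {0, 1, 2, 3, 4, 5, 6, 7, 8 :: nat}" by auto

text \<open>
  Around an integer \<open>k\<close> the factors \<open>2 powr - k\<close>, \<open>3 powr - k\<close> and \<open>4 powr - k\<close> are rational, and only the
  exponentials of the small quantity \<open>t\<close> have to be approximated.
\<close>
lemma zeta_main_D3_shift:
  fixes k :: nat and t :: real
  defines "u \<equiv> real k + t"
  shows "zeta_main_D3 u =
      (3/2 * (ln 2)\<^sup>2 - (ln 2) ^ 3 / 2 * u) / 2 ^ k * exp (- ln 2 * t)
    + ((ln 3)\<^sup>2 - (ln 3) ^ 3 / 3 * u) / 3 ^ k * exp (- ln 3 * t)
    + (- (8 * (ln 2) ^ 3) * (192 + 25 * u + u\<^sup>2) / 192 + (ln 2)\<^sup>2 * (25 + 2 * u) / 16 - ln 2 / 16) / 4 ^ k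
        * exp (- ln 4 * t)"
proof -
  have e: "exp (- ln 2 * u) = exp (- ln 2 * t) / 2 ^ k" "exp (- ln 3 * u) = exp (- ln 3 * t) / 3 ^ k"
      "exp (- ln 4 * u) = exp (- ln 4 * t) / 4 ^ k"
    unfolding u_def using exp_neg_ln_shift[of 2 k t] exp_neg_ln_shift[of 3 k t] exp_neg_ln_shift[of 4 k t] by simp_all
  define x y z where "x = exp (- ln 2 * t) / 2 ^ k" "y = exp (- ln 3 * t) / 3 ^ k" "z = exp (- ln 4 * t) / 4 ^ k"
  have "zeta_main_D3 u = (3/2 * (ln 2)\<^sup>2 - (ln 2) ^ 3 / 2 * u) * x + ((ln 3)\<^sup>2 - (ln 3) ^ 3 / 3 * u) * y
    + (- (8 * (ln 2) ^ 3) * (192 + 25 * u + u\<^sup>2) / 192 + (ln 2)\<^sup>2 * (25 + 2 * u) / 16 - ln 2 / 16) * z"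
    unfolding zeta_main_D3_def quad_exp_def of_real_eq_id id_apply e x_y_z_def[symmetric]
    by (simp add: ln_4_eq field_simps power2_eq_square power3_eq_cube)
  thus ?thesis by (simp add: x_y_z_def)
qed

lemma quadratic_times_approx:
  fixes t x y :: real
  assumes t: "\<bar>t\<bar> \<le> 1" and x: "\<bar>x\<bar> \<le> 4" "\<bar>x - y\<bar> \<le> \<delta>"
    and e: "\<bar>a - a'\<bar> \<le> e" "\<bar>b - b'\<bar> \<le> e" "\<bar>c - c'\<bar> \<le> e"
    and r: "12 * e + (\<bar>a'\<bar> + \<bar>b'\<bar> + \<bar>c'\<bar>) * \<delta> \<le> r"
  shows "\<bar>poly [:a, b, c:] t * x - poly [:a', b', c':] t * y\<bar> \<le> r"
proof -
  have t2: "\<bar>t\<^sup>2\<bar> \<le> 1" using t by (simp add: power_le_one abs_square_le_1)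
  have "\<bar>(a - a') + (b - b') * t + (c - c') * t\<^sup>2\<bar> \<le> \<bar>a - a'\<bar> + \<bar>b - b'\<bar> * \<bar>t\<bar> + \<bar>c - c'\<bar> * \<bar>t\<^sup>2\<bar>"
    unfolding abs_mult[symmetric] by linarith
  also have "\<dots> \<le> e + e * 1 + e * 1"
    using e t t2 by (intro add_mono mult_mono) auto
  finally have 1: "\<bar>(a - a') + (b - b') * t + (c - c') * t\<^sup>2\<bar> \<le> 3 * e" by simp
  have "\<bar>a' + b' * t + c' * t\<^sup>2\<bar> \<le> \<bar>a'\<bar> + \<bar>b'\<bar> * \<bar>t\<bar> + \<bar>c'\<bar> * \<bar>t\<^sup>2\<bar>"
    unfolding abs_mult[symmetric] by linarith
  also have "\<dots> \<le> \<bar>a'\<bar> + \<bar>b'\<bar> * 1 + \<bar>c'\<bar> * 1"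
    using t t2 by (intro add_mono mult_mono) auto
  finally have 2: "\<bar>a' + b' * t + c' * t\<^sup>2\<bar> \<le> \<bar>a'\<bar> + \<bar>b'\<bar> + \<bar>c'\<bar>" by simp
  have "poly [:a, b, c:] t = a + b * t + c * t\<^sup>2" for a b c
    by (simp add: algebra_simps power2_eq_square)
  hence "\<bar>poly [:a, b, c:] t * x - poly [:a', b', c':] t * y\<bar>
      = \<bar>(a + b * t + c * t\<^sup>2) * x - (a' + b' * t + c' * t\<^sup>2) * y\<bar>"
    by (simp only:)
  also have "\<dots>
      = \<bar>((a - a') + (b - b') * t + (c - c') * t\<^sup>2) * x + (a' + b' * t + c' * t\<^sup>2) * (x - y)\<bar>"
    by (simp add: algebra_simps)
  also have "\<dots> \<le> \<bar>(a - a') + (b - b') * t + (c - c') * t\<^sup>2\<bar> * \<bar>x\<bar> + \<bar>a' + b' * t + c' * t\<^sup>2\<bar> * \<bar>x - y\<bar>"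
    unfolding abs_mult[symmetric] by (rule abs_triangle_ineq)
  also have "\<dots> \<le> (3 * e) * 4 + (\<bar>a'\<bar> + \<bar>b'\<bar> + \<bar>c'\<bar>) * \<delta>"
    by (intro add_mono mult_mono 1 2 x) (use e(1) in simp_all)
  finally show ?thesis using r by simp
qed

lemma exp_neg_le_4:
  assumes "0 \<le> L" "L \<le> ln 4" "\<bar>t\<bar> \<le> (1 :: real)"
  shows "\<bar>exp (- L * t)\<bar> \<le> 4"
proof -
  have "- L * t \<le> ln 4"
    using mult_mono[of L "ln 4" "\<bar>t\<bar>" 1] assms abs_ge_self[of "- L * t"] by (simp add: abs_mult)
  hence "exp (- L * t) \<le> exp (ln 4)" by (simp only: exp_le_cancel_iff)
  thus ?thesis by simp
qed

lemma abs_poly_le: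
  fixes p :: "real poly"
  assumes "\<bar>t\<bar> \<le> 1"
  shows "\<bar>poly p t\<bar> \<le> sum_list (map abs (coeffs p))"
proof (induction p)
  case (pCons a p)
  have "\<bar>poly (pCons a p) t\<bar> \<le> \<bar>a\<bar> + \<bar>t\<bar> * \<bar>poly p t\<bar>"
    unfolding abs_mult[symmetric] by simp
  also have "\<bar>t\<bar> * \<bar>poly p t\<bar> \<le> 1 * \<bar>poly p t\<bar>"
    using assms by (intro mult_right_mono) auto
  finally show ?case using pCons by (auto simp: cCons_def)
qed simp

lemma poly_pCons_in_interval:
  assumes "\<bar>t\<bar> \<le> 1" "sum_list (map abs (coeffs p)) \<le> r" "(c :: real) \<in> {l + r..h - r}"
  shows "poly (pCons c p) t \<in> {l..h}"
proof -
  have "\<bar>t * poly p t\<bar> \<le> r"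
    using mult_mono[of "\<bar>t\<bar>" 1 "\<bar>poly p t\<bar>" r] abs_poly_le[OF assms(1), of p] assms(1,2)
    by (simp add: abs_mult)
  thus ?thesis using assms(3) by (auto simp: abs_le_iff)
qed

lemma sum3_approx:
  fixes x y z :: real
  assumes "\<bar>x - x'\<bar> \<le> d" "\<bar>y - y'\<bar> \<le> e" "\<bar>z - z'\<bar> \<le> f"
    and "x' + y' + z' \<in> {l'..h'}" "l \<le> l' - (d + e + f)" "h' + (d + e + f) \<le> h"
  shows "x + y + z \<in> {l..h}"
  using assms unfolding atLeastAtMost_iff by linarith

text \<open>
  The achieved error is an outcome of the computation, so the statements leave it open and the last step of each
  proof fills it in.  The same holds for the two interval estimates further below.
\<close>
schematic_goal exp_ln_2_approx:
  fixes t :: real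
  assumes t: "\<bar>t\<bar> \<le> 1"
  shows "\<bar>exp (- ln 2 * t) - poly [:1, -0.69315, 0.24023, -0.0555, 0.00962, -0.00133, 0.00015, -0.00002:] t\<bar> \<le> ?e"
proof -
  let ?c = "\<lambda>j. [1 :: real, 0.69315, 0.24023, 0.0555, 0.00962, 0.00133, 0.00015, 0.00002, 0] ! j"
  have c: "?c j - 1/100000 \<le> (693147/1000000) ^ j / fact j \<and> (693148/1000000) ^ j / fact j \<le> ?c j + 1/100000"
    if "j < 9" for j
    using less_9_cases[OF that] by (elim insertE emptyE) (simp_all add: fact_numeral power_divide)
  have "\<bar>exp (- ln 2 * t) - (\<Sum>j<9. ?c j * (- t) ^ j)\<bar> \<le> 31/100000"
    using ln_2_bounds ln_3_bounds by (intro exp_neg_approx[OF _ _ _ _ t c]) (auto simp: ln_4_eq)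
  also have "(\<Sum>j<9. ?c j * (- t) ^ j) = poly [:1, -0.69315, 0.24023, -0.0555, 0.00962, -0.00133, 0.00015, -0.00002:] t"
    by (simp add: lessThan_nat_numeral algebra_simps eval_nat_numeral)
  finally show "\<bar>exp (- ln 2 * t) - poly [:1, -0.69315, 0.24023, -0.0555, 0.00962, -0.00133, 0.00015, -0.00002:] t\<bar> \<le> 31/100000" .
qed

schematic_goal exp_ln_3_approx:
  fixes t :: real
  assumes t: "\<bar>t\<bar> \<le> 1"
  shows "\<bar>exp (- ln 3 * t) - poly [:1, -1.09861, 0.60347, -0.22099, 0.0607, -0.01334, 0.00244, -0.00038, 0.00005:] t\<bar> \<le> ?e"
proof -
  let ?c = "\<lambda>j. [1 :: real, 1.09861, 0.60347, 0.22099, 0.0607, 0.01334, 0.00244, 0.00038, 0.00005] ! j"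
  have c: "?c j - 1/100000 \<le> (1098611/1000000) ^ j / fact j \<and> (1098613/1000000) ^ j / fact j \<le> ?c j + 1/100000"
    if "j < 9" for j
    using less_9_cases[OF that] by (elim insertE emptyE) (simp_all add: fact_numeral power_divide)
  have "\<bar>exp (- ln 3 * t) - (\<Sum>j<9. ?c j * (- t) ^ j)\<bar> \<le> 31/100000"
    using ln_2_bounds ln_3_bounds by (intro exp_neg_approx[OF _ _ _ _ t c]) (auto simp: ln_4_eq)
  also have "(\<Sum>j<9. ?c j * (- t) ^ j) = poly [:1, -1.09861, 0.60347, -0.22099, 0.0607, -0.01334, 0.00244, -0.00038, 0.00005:] t"
    by (simp add: lessThan_nat_numeral algebra_simps eval_nat_numeral)
  finally show "\<bar>exp (- ln 3 * t) - poly [:1, -1.09861, 0.60347, -0.22099, 0.0607, -0.01334, 0.00244, -0.00038, 0.00005:] t\<bar> \<le> 31/100000" .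
qed

schematic_goal exp_ln_4_approx:
  fixes t :: real
  assumes t: "\<bar>t\<bar> \<le> 1"
  shows "\<bar>exp (- ln 4 * t) - poly [:1, -1.38629, 0.96091, -0.44403, 0.15389, -0.04267, 0.00986, -0.00195, 0.00034:] t\<bar> \<le> ?e"
proof -
  let ?c = "\<lambda>j. [1 :: real, 1.38629, 0.96091, 0.44403, 0.15389, 0.04267, 0.00986, 0.00195, 0.00034] ! j"
  have c: "?c j - 1/100000 \<le> (1386294/1000000) ^ j / fact j \<and> (1386296/1000000) ^ j / fact j \<le> ?c j + 1/100000"
    if "j < 9" for j
    using less_9_cases[OF that] by (elim insertE emptyE) (simp_all add: fact_numeral power_divide)
  have "\<bar>exp (- ln 4 * t) - (\<Sum>j<9. ?c j * (- t) ^ j)\<bar> \<le> 31/100000"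
    using ln_2_bounds ln_3_bounds by (intro exp_neg_approx[OF _ _ _ _ t c]) (auto simp: ln_4_eq)
  also have "(\<Sum>j<9. ?c j * (- t) ^ j) = poly [:1, -1.38629, 0.96091, -0.44403, 0.15389, -0.04267, 0.00986, -0.00195, 0.00034:] t"
    by (simp add: lessThan_nat_numeral algebra_simps eval_nat_numeral)
  finally show "\<bar>exp (- ln 4 * t) - poly [:1, -1.38629, 0.96091, -0.44403, 0.15389, -0.04267, 0.00986, -0.00195, 0.00034:] t\<bar> \<le> 31/100000" .
qed

text \<open>
  Replacing the three exponentials by polynomials, and the coefficients by decimals, turns the
  function into a polynomial of degree 10.  The three terms are large and nearly cancel: apart from
  the constant coefficient, all coefficients of their sum are so small that it suffices to add up
  their absolute values.
\<close>
schematic_goal zeta_main_D3_near_1: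
  fixes t :: real
  assumes t: "\<bar>t\<bar> \<le> 1"
  shows "zeta_main_D3 (1 + t) \<in> {?l..?h}"
proof -
  let ?a2 = "[:(3/2 * (ln 2)\<^sup>2 - 1/2 * (ln 2) ^ 3) / 2, - ((ln 2) ^ 3) / 4, 0:]"
  let ?a3 = "[:((ln 3)\<^sup>2 - 1/3 * (ln 3) ^ 3) / 3, - ((ln 3) ^ 3) / 9, 0:]"
  let ?a4 = "[:(- 8 * (ln 2) ^ 3 * 218 / 192 + (ln 2)\<^sup>2 * 27 / 16 - ln 2 / 16) / 4,
      (- 8 * (ln 2) ^ 3 * 27 / 192 + (ln 2)\<^sup>2 / 8) / 4, - 8 * (ln 2) ^ 3 / 768:]"
  have eq: "zeta_main_D3 (1 + t)
      = poly ?a2 t * exp (- ln 2 * t) + poly ?a3 t * exp (- ln 3 * t) + poly ?a4 t * exp (- ln 4 * t)"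
    using zeta_main_D3_shift[of 1 t] by (simp add: field_simps power2_eq_square)
  let ?p2 = "[:0.27708, -0.08326, 0:] :: real poly" and ?q2 = "[:1, -0.69315, 0.24023, -0.0555, 0.00962, -0.00133, 0.00015, -0.00002:] :: real poly"
  have e2: "\<bar>poly ?a2 t * exp (- ln 2 * t) - poly ?p2 t * poly ?q2 t\<bar> \<le> 232/1000000"
    using ln_2_square_bounds ln_2_cube_bounds
    by (intro quadratic_times_approx[where e = "1/100000", OF t exp_neg_le_4[OF _ _ t] exp_ln_2_approx[OF t]])
       (auto simp: abs_le_iff field_simps)
  let ?p3 = "[:0.25499, -0.14733, 0:] :: real poly" and ?q3 = "[:1, -1.09861, 0.60347, -0.22099, 0.0607, -0.01334, 0.00244, -0.00038, 0.00005:] :: real poly"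
  have e3: "\<bar>poly ?a3 t * exp (- ln 3 * t) - poly ?p3 t * poly ?q3 t\<bar> \<le> 245/1000000"
    using ln_3_square_bounds ln_3_cube_bounds
    by (intro quadratic_times_approx[where e = "1/100000", OF t exp_neg_le_4[OF _ _ t] exp_ln_3_approx[OF t]])
       (auto simp: abs_le_iff field_simps)
  let ?p4 = "[:-0.56438, -0.07865, -0.00347:] :: real poly" and ?q4 = "[:1, -1.38629, 0.96091, -0.44403, 0.15389, -0.04267, 0.00986, -0.00195, 0.00034:] :: real poly"
  have e4: "\<bar>poly ?a4 t * exp (- ln 4 * t) - poly ?p4 t * poly ?q4 t\<bar> \<le> 321/1000000"
    using ln_2_bounds ln_2_square_bounds ln_2_cube_bounds
    by (intro quadratic_times_approx[where e = "1/100000", OF t exp_neg_le_4[OF _ _ t] exp_ln_4_approx[OF t]])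
       (auto simp: abs_le_iff field_simps)
  have "poly ?p2 t * poly ?q2 t + poly ?p3 t * poly ?q3 t + poly ?p4 t * poly ?q4 t
      = poly (?p2 * ?q2 + ?p3 * ?q3 + ?p4 * ?q4) t"
    by (simp only: poly_mult poly_add)
  also have "?p2 * ?q2 + ?p3 * ?q3 + ?p4 * ?q4 = [:-0.03231, 0.0009617843, 0.0032549467, -0.0008024588,
       0.0000589529, 0.000005455, -0.000002934,
       -0.0000012951, -0.0000023358, -0.000027341, -0.0000011798:]"
    by simp
  also have "poly \<dots> t \<in> {-381/10000..-269/10000}"
    by (rule poly_pCons_in_interval[OF t, where r = "52/10000"]) (simp_all add: cCons_def)
  finally show "zeta_main_D3 (1 + t) \<in> {-39/1000..-26/1000}" unfolding eq by (rule sum3_approx[OF e2 e3 e4]) simp_all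
qed

text \<open>
  The same computation around 3.
\<close>
schematic_goal zeta_main_D3_near_3:
  fixes t :: real
  assumes t: "\<bar>t\<bar> \<le> 1"
  shows "zeta_main_D3 (3 + t) \<in> {?l..?h}"
proof -
  let ?a2 = "[:(3/2 * (ln 2)\<^sup>2 - 3/2 * (ln 2) ^ 3) / 8, - ((ln 2) ^ 3) / 16, 0:]"
  let ?a3 = "[:((ln 3)\<^sup>2 - (ln 3) ^ 3) / 27, - ((ln 3) ^ 3) / 81, 0:]"
  let ?a4 = "[:(- 8 * (ln 2) ^ 3 * 276 / 192 + (ln 2)\<^sup>2 * 31 / 16 - ln 2 / 16) / 64,
      (- 8 * (ln 2) ^ 3 * 31 / 192 + (ln 2)\<^sup>2 / 8) / 64, - 8 * (ln 2) ^ 3 / 12288:]"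
  have eq: "zeta_main_D3 (3 + t)
      = poly ?a2 t * exp (- ln 2 * t) + poly ?a3 t * exp (- ln 3 * t) + poly ?a4 t * exp (- ln 4 * t)"
    using zeta_main_D3_shift[of 3 t] by (simp add: field_simps power2_eq_square)
  let ?p2 = "[:0.02764, -0.02081, 0:] :: real poly" and ?q2 = "[:1, -0.69315, 0.24023, -0.0555, 0.00962, -0.00133, 0.00015, -0.00002:] :: real poly"
  have e2: "\<bar>poly ?a2 t * exp (- ln 2 * t) - poly ?p2 t * poly ?q2 t\<bar> \<le> 136/1000000"
    using ln_2_square_bounds ln_2_cube_bounds
    by (intro quadratic_times_approx[where e = "1/100000", OF t exp_neg_le_4[OF _ _ t] exp_ln_2_approx[OF t]])
       (auto simp: abs_le_iff field_simps)
  let ?p3 = "[:-0.00441, -0.01637, 0:] :: real poly" and ?q3 = "[:1, -1.09861, 0.60347, -0.22099, 0.0607, -0.01334, 0.00244, -0.00038, 0.00005:] :: real poly"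
  have e3: "\<bar>poly ?a3 t * exp (- ln 3 * t) - poly ?p3 t * poly ?q3 t\<bar> \<le> 127/1000000"
    using ln_3_square_bounds ln_3_cube_bounds
    by (intro quadratic_times_approx[where e = "1/100000", OF t exp_neg_le_4[OF _ _ t] exp_ln_3_approx[OF t]])
       (auto simp: abs_le_iff field_simps)
  let ?p4 = "[:-0.04597, -0.00578, -0.00022:] :: real poly" and ?q4 = "[:1, -1.38629, 0.96091, -0.44403, 0.15389, -0.04267, 0.00986, -0.00195, 0.00034:] :: real poly"
  have e4: "\<bar>poly ?a4 t * exp (- ln 4 * t) - poly ?p4 t * poly ?q4 t\<bar> \<le> 137/1000000"
    using ln_2_bounds ln_2_square_bounds ln_2_cube_bounds
    by (intro quadratic_times_approx[where e = "1/100000", OF t exp_neg_le_4[OF _ _ t] exp_ln_4_approx[OF t]])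
       (auto simp: abs_le_iff field_simps)
  have "poly ?p2 t * poly ?q2 t + poly ?p3 t * poly ?q3 t + poly ?p4 t * poly ?q4 t
      = poly (?p2 * ?q2 + ?p3 * ?q3 + ?p4 * ?q4) t"
    by (simp only: poly_mult poly_add)
  also have "?p2 * ?q2 + ?p3 * ?q3 + ?p4 * ?q4 = [:-0.02274, 0.0064539554, 0.0000070752, -0.0002744612,
       0.000051541, -0.0000020407, -0.0000010487,
       0.0000000968, -0.0000001117, -0.0000023547, -0.0000000748:]"
    by simp
  also have "poly \<dots> t \<in> {-305/10000..-155/10000}"
    by (rule poly_pCons_in_interval[OF t, where r = "68/10000"]) (simp_all add: cCons_def)
  finally show "zeta_main_D3 (3 + t) \<in> {-31/1000..-15/1000}" unfolding eq by (rule sum3_approx[OF e2 e3 e4]) simp_all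
qed

text \<open>
  The key numerical fact: the second derivative of the main part is almost linear on the whole interval.
\<close>
lemma zeta_main_D3_bounds:
  fixes u :: real
  assumes "u \<in> {0..3}"
  shows "zeta_main_D3 u \<in> {-39/1000..-15/1000}"
proof (cases "u \<le> 2")
  case True
  thus ?thesis using zeta_main_D3_near_1[of "u - 1"] assms by (auto simp: abs_le_iff)
next
  case False
  thus ?thesis using zeta_main_D3_near_3[of "u - 3"] assms by (auto simp: abs_le_iff)
qed

theorem theorem3:
  fixes s :: real
  assumes "s \<in> {1..4}"
  shows "let \<gamma> = euler_mascheroni;
             \<gamma>\<^sub>1 = stieltjes 1;
             D2 = (deriv ^^ 2) (remove_sings (\<lambda>z. (z - 1) * zeta z)) (of_real s)
         in D2 \<in> \<real> \<and>
            (- 2 * \<gamma>\<^sub>1 * (1 - \<gamma>)\<^sup>2) / (1 - \<gamma> - 2 * \<gamma>\<^sub>1 * (s - 1))\<^sup>2 \<le> Re D2 \<and>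
            Re D2 \<le> - ((2 * \<gamma>\<^sub>1 - 1 / 4 * (1 - \<gamma>) * (s - 1) - 1 / 4 * \<gamma>\<^sub>1 * (s - 1)\<^sup>2)
                       / (1 + 1 / 8 * (s - 1)\<^sup>2)\<^sup>2)"
  using assms zeta_main_D3_bounds by (rule second_derivative_bounds)

end
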